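(* Let $(r^+,r^-)\in\mathcal S^2$, $D\ge0$, $\mathrm{sgn}\in\{+,-\}^D$, and assume $A^{D,\mathrm{sgn}}_{(r^+,r^-)}(t,[\tau_1,\dots,\tau_D])$ is differentiable with respect to $t$ and $\tau_1$. Then for $t>0$ and $(\tau_1,\dots,\tau_D)\in\triangle_T^{(D)}$, $$\frac{\partial}{\partial t}A^{D,\mathrm{sgn}}_{(r^+,r^-)}(t,[\tau_1,\dots,\tau_D])=-W^{D,\mathrm{sgn}}_{(r^+,r^-)}([\tau_1,\dots,\tau_D])\,A^{D,\mathrm{sgn}}_{(r^+,r^-)}(t,[\tau_1,\dots,\tau_D])+A^{D+1,[-,\mathrm{sgn}]}_{(r^+,\hat r^-)}(t,[0,\tau_1,\dots,\tau_D])+A^{D+1,[+,\mathrm{sgn}]}_{(\hat r^+,r^-)}(t,[0,\tau_1,\dots,\tau_D])+\frac{\partial}{\partial\tau_1}A^{D,\mathrm{sgn}}_{(r^+,r^-)}(t,[\tau_1,\dots,\tau_D]),$$ where for $D=0$ the derivative with respect to $\tau_1$ is taken to be zero.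
   Context: Let $\mathcal S=\{-1,+1\}$, $\{|-1\rangle,|+1\rangle\}$ an orthonormal basis of $\mathbb C^2$, $H_0$ a Hermitian operator on $\mathbb C^2$, $\rho_s(0)$ a $2\times2$ complex matrix, and $T>0$. Let $\tilde\eta(\tau)=\frac1\pi\int_0^\infty J(\omega)(\coth(\beta\omega/2)\cos\omega\tau-i\sin\omega\tau)d\omega$ with $\beta>0$, $J(\omega)=\frac\pi2\sum_j\frac{c_j^2}{m_j\omega_j}\delta(\omega-\omega_j)$ ($\omega_j>0$); $\tilde\eta$ is continuous and $z^*$ is complex conjugation. For $a\in\mathcal S$ let $\hat a=-a$; for $r=(r^+,r^-)\in\mathcal S^2$ let $E(r)=\langle r^+|H_0|r^+\rangle-\langle r^-|H_0|r^-\rangle$. For $L>0$, $D\ge0$: $\triangle_L^{(D)}=\{(\tau_1,\dots,\tau_D):\tau_k>0,\sum\tau_k<L\}$ (a single point if $D=0$, integration over it meaning evaluation). For a sign list $\mathrm{sgn}$, $[\pm,\mathrm{sgn}]$ denotes the list with $\pm$ prepended. Path segments: given $r_0\in\mathcal S^2$, $D\ge0$, $\mathrm{sgn}\in\{+,-\}^D$, define $r_1,\dots,r_D$ by: $r_j$ is $r_{j-1}$ with its $+$ component flipped ($a\mapsto\hat a$) if $\mathrm{sgn}_j=+$, or its $-$ component flipped if $\mathrm{sgn}_j=-$; the final state is $r_f=r_D$. For $\boldsymbol\tau\in\triangle_L^{(D)}$ the path segment on $[0,L)$ equals $r_d$ on $[\sum_{k\le d}\tau_k,\sum_{k\le d+1}\tau_k)$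 ($0\le d<D$) and $r_D$ on $[\sum_{k\le D}\tau_k,L)$. Its flip factors are $V_j=-i\langle r_j^+|H_0|r_{j-1}^+\rangle$ if $\mathrm{sgn}_j=+$ and $V_j=i\langle r_{j-1}^-|H_0|r_j^-\rangle$ if $\mathrm{sgn}_j=-$; its piece lengths are $\ell_0=\tau_1$, $\ell_j=\tau_{j+1}$ ($1\le j<D$), $\ell_D=L-\sum\tau_k$ ($\ell_0=L$ if $D=0$). For $t\ge0$ let $h=(h^+,h^-)$ be the path segment on $[0,T)$ with data $(r_0,D,\mathrm{sgn},\boldsymbol\tau)$ and $Y(h)=\prod_{j=0}^De^{-iE(r_j)\ell_j}\prod_{j=1}^DV_j$. For $\tilde D\ge0$, $\tilde r_0\in\mathcal S^2$, $\widetilde{\mathrm{sgn}}\in\{+,-\}^{\tilde D}$, $\tilde{\boldsymbol\tau}\in\triangle_t^{(\tilde D)}$, let $g=(g^+,g^-)$ be the path segment on $[0,t)$ with these data (states $\tilde r_j$, flip factors $\tilde V_j$, lengths $\tilde\ell_j$) and $X(g)=\langle\tilde r_0^+|\rho_s(0)|\tilde r_0^-\rangle\prod_{j=0}^{\tilde D}e^{-iE(\tilde r_j)\tilde\ell_j}\prod_{j=1}^{\tilde D}\tilde V_j$. Let $Z(g,h)=-\int_0^tdx_1\int_{\max(0,x_1-T)}^{x_1}dx_2\,(g^+(x_1)-g^-(x_1))(g^+(x_2)\tilde\eta(x_1-x_2)-g^-(x_2)\tilde\eta^*(x_1-x_2))-\int_t^{t+T}dx_1\int_{\max(0,x_1-T)}^{t}dx_2\,(h^+(x_1-t)-h^-(x_1-t))(g^+(x_2)\tilde\eta(x_1-x_2)-g^-(x_2)\tilde\eta^*(x_1-x_2))-\int_0^Tdx_1\int_0^{x_1}dx_2\,(h^+(x_1)-h^-(x_1))(h^+(x_2)\tilde\eta(x_1-x_2)-h^-(x_2)\tilde\eta^*(x_1-x_2))$.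 For $\boldsymbol\tau\in\triangle_T^{(D)}$: $A^{D,\mathrm{sgn}}_{r_0}(t,[\tau_1,\dots,\tau_D]):=\sum_{\tilde D=0}^\infty\sum_{\tilde r_0\in\mathcal S^2}\sum_{\widetilde{\mathrm{sgn}}\in\{+,-\}^{\tilde D}}\int_{\triangle_t^{(\tilde D)}}X(g)\,\mathbf 1[\tilde r_{\tilde D}=r_0]\,Y(h)\,e^{Z(g,h)}\,d\tilde{\boldsymbol\tau}$. For $\boldsymbol\tau$ in the boundary $\partial\triangle_T^{(D)}$, $A^{D,\mathrm{sgn}}_{r_0}(t,\boldsymbol\tau)$ is defined as the limit of $A^{D,\mathrm{sgn}}_{r_0}(t,\boldsymbol\tau')$ as $\boldsymbol\tau'\to\boldsymbol\tau$ within $\triangle_T^{(D)}$ (this limit exists). Finally $W^{D,\mathrm{sgn}}_{r_0}([\tau_1,\dots,\tau_D])=\int_0^T(r_f^+-r_f^-)\big(\tilde\eta(s)h^+(T-s)-\tilde\eta^*(s)h^-(T-s)\big)ds+i\big(\langle r_f^+|H_0|r_f^+\rangle-\langle r_f^-|H_0|r_f^-\rangle\big)$, where $h$ is the path segment with data $(r_0,D,\mathrm{sgn},\boldsymbol\tau)$ and $r_f=r_D$ is its left limit at $T$. *)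

theory Defs
  imports "HOL-Analysis.Analysis"
begin

text \<open>Spins are the integers -1 and +1; a state r = (r+, r-) is a pair of spins.
  Operators on C^2 are represented by their matrix entries in the fixed orthonormal
  basis: op a b = <a|Op|b> for a, b in spins.\<close>

definition spins :: "int set" where "spins = {-1, 1}"

datatype sign = Pl | Mi

definition flipst :: "sign \<Rightarrow> int \<times> int \<Rightarrow> int \<times> int" where
  "flipst s r = (case s of Pl \<Rightarrow> (- fst r, snd r) | Mi \<Rightarrow> (fst r, - snd r))"

definition states :: "int \<times> int \<Rightarrow> sign list \<Rightarrow> nat \<Rightarrow> int \<times> int" where
  "states r0 sg j = foldl (\<lambda>r s. flipst s r) r0 (take j sg)"

text \<open>Time vectors (tau_1,...,tau_D) are functions nat => real, tau_(k+1) = tau k, k < D,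
  extensional outside {..<D}.\<close>
definition cum :: "(nat \<Rightarrow> real) \<Rightarrow> nat \<Rightarrow> real" where
  "cum \<tau> k = (\<Sum>i<k. \<tau> i)"

definition tsimplex :: "real \<Rightarrow> nat \<Rightarrow> (nat \<Rightarrow> real) set" where
  "tsimplex L D = {\<tau> \<in> PiE {..<D} (\<lambda>_. UNIV). (\<forall>k<D. 0 < \<tau> k) \<and> (D = 0 \<or> cum \<tau> D < L)}"

definition seg :: "int \<times> int \<Rightarrow> sign list \<Rightarrow> (nat \<Rightarrow> real) \<Rightarrow> real \<Rightarrow> int \<times> int" where
  "seg r0 sg \<tau> x = states r0 sg (card {k \<in> {1..length sg}. cum \<tau> k \<le> x})"

definition energy :: "(int \<Rightarrow> int \<Rightarrow> complex) \<Rightarrow> int \<times> int \<Rightarrow> complex" where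
  "energy H r = H (fst r) (fst r) - H (snd r) (snd r)"

definition flipfac :: "(int \<Rightarrow> int \<Rightarrow> complex) \<Rightarrow> int \<times> int \<Rightarrow> sign list \<Rightarrow> nat \<Rightarrow> complex" where
  "flipfac H r0 sg j = (case sg ! (j - 1) of
      Pl \<Rightarrow> - \<i> * H (fst (states r0 sg j)) (fst (states r0 sg (j - 1)))
    | Mi \<Rightarrow> \<i> * H (snd (states r0 sg (j - 1))) (snd (states r0 sg j)))"

definition piecelen :: "real \<Rightarrow> nat \<Rightarrow> (nat \<Rightarrow> real) \<Rightarrow> nat \<Rightarrow> real" where
  "piecelen L D \<tau> j = (if j < D then \<tau> j else L - cum \<tau> D)"

definition Yw :: "(int \<Rightarrow> int \<Rightarrow> complex) \<Rightarrow> real \<Rightarrow> int \<times> int \<Rightarrow> sign list \<Rightarrow> (nat \<Rightarrow> real) \<Rightarrow> complex" where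
  "Yw H L r0 sg \<tau> =
     (\<Prod>j\<in>{0..length sg}. exp (- \<i> * energy H (states r0 sg j) * complex_of_real (piecelen L (length sg) \<tau> j)))
     * (\<Prod>j\<in>{1..length sg}. flipfac H r0 sg j)"

definition Xw :: "(int \<Rightarrow> int \<Rightarrow> complex) \<Rightarrow> (int \<Rightarrow> int \<Rightarrow> complex) \<Rightarrow> real \<Rightarrow> int \<times> int \<Rightarrow> sign list \<Rightarrow> (nat \<Rightarrow> real) \<Rightarrow> complex" where
  "Xw H \<rho> L r0 sg \<tau> = \<rho> (fst r0) (snd r0) * Yw H L r0 sg \<tau>"

definition coth :: "real \<Rightarrow> real" where "coth x = cosh x / sinh x"

text \<open>Summand of eta~(tau) = (1/pi) int J(w) (...) dw with J = (pi/2) sum_j c_j^2/(m_j w_j) delta(w - w_j).\<close>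
definition eta_term :: "('j \<Rightarrow> real) \<Rightarrow> ('j \<Rightarrow> real) \<Rightarrow> ('j \<Rightarrow> real) \<Rightarrow> real \<Rightarrow> real \<Rightarrow> 'j \<Rightarrow> complex" where
  "eta_term c m \<omega> \<beta> \<tau> j = complex_of_real (c j ^ 2 / (m j * \<omega> j) / 2) *
     (complex_of_real (coth (\<beta> * \<omega> j / 2) * cos (\<omega> j * \<tau>)) - \<i> * complex_of_real (sin (\<omega> j * \<tau>)))"

definition eta :: "('j \<Rightarrow> real) \<Rightarrow> ('j \<Rightarrow> real) \<Rightarrow> ('j \<Rightarrow> real) \<Rightarrow> real \<Rightarrow> real \<Rightarrow> complex" where
  "eta c m \<omega> \<beta> \<tau> = infsum (eta_term c m \<omega> \<beta> \<tau>) UNIV"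

definition pc :: "(real \<Rightarrow> int \<times> int) \<Rightarrow> real \<Rightarrow> complex" where
  "pc g x = complex_of_real (real_of_int (fst (g x)))"
definition mc :: "(real \<Rightarrow> int \<times> int) \<Rightarrow> real \<Rightarrow> complex" where
  "mc g x = complex_of_real (real_of_int (snd (g x)))"

definition Zexp :: "(real \<Rightarrow> complex) \<Rightarrow> real \<Rightarrow> real \<Rightarrow> (real \<Rightarrow> int \<times> int) \<Rightarrow> (real \<Rightarrow> int \<times> int) \<Rightarrow> complex" where
  "Zexp et t T g h =
     - integral {0..t} (\<lambda>x1. integral {max 0 (x1 - T)..x1} (\<lambda>x2.
          (pc g x1 - mc g x1) * (pc g x2 * et (x1 - x2) - mc g x2 * cnj (et (x1 - x2)))))
     - integral {t..t + T} (\<lambda>x1. integral {max 0 (x1 - T)..t} (\<lambda>x2.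
          (pc h (x1 - t) - mc h (x1 - t)) * (pc g x2 * et (x1 - x2) - mc g x2 * cnj (et (x1 - x2)))))
     - integral {0..T} (\<lambda>x1. integral {0..x1} (\<lambda>x2.
          (pc h x1 - mc h x1) * (pc h x2 * et (x1 - x2) - mc h x2 * cnj (et (x1 - x2)))))"

definition Aint :: "(int \<Rightarrow> int \<Rightarrow> complex) \<Rightarrow> (int \<Rightarrow> int \<Rightarrow> complex) \<Rightarrow> (real \<Rightarrow> complex) \<Rightarrow> real
     \<Rightarrow> int \<times> int \<Rightarrow> sign list \<Rightarrow> real \<Rightarrow> (nat \<Rightarrow> real) \<Rightarrow> complex" where
  "Aint H \<rho> et T r0 sg t \<tau> =
     (\<Sum>Dt. \<Sum>rt\<in>spins \<times> spins. \<Sum>sgt\<in>{l. length l = Dt}.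
        (LINT \<tau>t : tsimplex t Dt | PiM {..<Dt} (\<lambda>_. lborel).
           Xw H \<rho> t rt sgt \<tau>t * (if states rt sgt Dt = r0 then 1 else 0) * Yw H T r0 sg \<tau>
           * exp (Zexp et t T (seg rt sgt \<tau>t) (seg r0 sg \<tau>))))"

definition Aext :: "(int \<Rightarrow> int \<Rightarrow> complex) \<Rightarrow> (int \<Rightarrow> int \<Rightarrow> complex) \<Rightarrow> (real \<Rightarrow> complex) \<Rightarrow> real
     \<Rightarrow> int \<times> int \<Rightarrow> sign list \<Rightarrow> real \<Rightarrow> (nat \<Rightarrow> real) \<Rightarrow> complex" where
  "Aext H \<rho> et T r0 sg t \<tau> =
     (if \<tau> \<in> tsimplex T (length sg) then Aint H \<rho> et T r0 sg t \<tau>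
      else Lim (at \<tau> within tsimplex T (length sg)) (\<lambda>\<tau>'. Aint H \<rho> et T r0 sg t \<tau>'))"

definition Wfun :: "(int \<Rightarrow> int \<Rightarrow> complex) \<Rightarrow> (real \<Rightarrow> complex) \<Rightarrow> real
     \<Rightarrow> int \<times> int \<Rightarrow> sign list \<Rightarrow> (nat \<Rightarrow> real) \<Rightarrow> complex" where
  "Wfun H et T r0 sg \<tau> =
     (let rf = states r0 sg (length sg); h = seg r0 sg \<tau> in
      integral {0..T} (\<lambda>s. complex_of_real (real_of_int (fst rf - snd rf)) *
          (et s * pc h (T - s) - cnj (et s) * mc h (T - s)))
      + \<i> * (H (fst rf) (fst rf) - H (snd rf) (snd rf)))"

definition cons0 :: "nat \<Rightarrow> (nat \<Rightarrow> real) \<Rightarrow> nat \<Rightarrow> real" where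
  "cons0 D \<tau> = (\<lambda>k. if k = 0 then 0 else if k \<le> D then \<tau> (k - 1) else undefined)"

end

(*
  Let h be the segment on [0,T) and rewind it: A(t+e, tau) is compared with A(t, (tau_1+e, tau_2, ...)).
  The influence exponent depends on g and h only through the concatenated path, so a history g without
  a jump in [t,t+e) contributes exactly its weight at (t, (tau_1+e, ...)) times a factor that does not
  depend on g; this factor is 1 - e W + o(e), because the new strip of the double integral,
  t+T < x1 < t+T+e, only involves x2 > t. The remaining histories are parametrised by the time u of
  their last jump, which yields e times the two boundary values of A with D+1 jumps, up to o(e); the
  error is summable over the number of jumps because the simplex has volume t^n/n!. Dividing by e, the
  right-hand difference quotient in t converges to the right-hand side of the equation. Since the base
  point of the tau_1-quotient stays at time t, separate differentiability in t and tau_1 suffices.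
*)
theory Submission
  imports Defs
begin

section \<open>The influence exponent as a functional of the concatenated path\<close>

text \<open>Differentiating the series in t directly would meet a moving domain, phases and an
  exponent that all depend on t for each history separately; comparison with the delayed segment
  removes the dependence on the history. The delay has a price in phases. At the junction the
  history is in the initial state of h, so waiting there contributes the energy of that state.
  Stretching the first piece of h shortens its last piece, which trades this phase for one of the
  final state; this is where the energy term of W comes from. All error terms rest on one principle:
  exponents of two paths differ by O(m) if the paths differ on a set of measure m, and two step
  functions with jump times a_k and b_k differ on a set of measure at most the sum of |a_k - b_k|.
  Conventions at jump points and endpoints are thereby harmless. Limits pass through the sum over
  the number of jumps by Tannery's theorem; the majorant is an exponential series, taken at t + 1 so
  as to be uniform in e <= 1.\<close>

definition spin_path :: "(real \<Rightarrow> int \<times> int) \<Rightarrow> bool" where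
  "spin_path G \<longleftrightarrow> G \<in> borel \<rightarrow>\<^sub>M count_space UNIV \<and> range G \<subseteq> spins \<times> spins"

definition kern :: "(real \<Rightarrow> complex) \<Rightarrow> (real \<Rightarrow> int \<times> int) \<Rightarrow> real \<Rightarrow> real \<Rightarrow> complex" where
  "kern et G x1 x2 = (pc G x1 - mc G x1) * (pc G x2 * et (x1 - x2) - mc G x2 * cnj (et (x1 - x2)))"

text \<open>Memory window and causality are built into one planar set: \<open>fst p\<close> is the
  outer time x1, \<open>snd p\<close> the inner time x2. Trading iterated integrals for one integral
  over this set opens the way to Fubini and to estimates by area.\<close>

definition strip :: "real \<Rightarrow> real \<Rightarrow> real \<Rightarrow> (real \<times> real) set" where
  "strip T a b = {p. a \<le> fst p \<and> fst p \<le> b \<and> max 0 (fst p - T) \<le> snd p \<and> snd p \<le> fst p}"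

text \<open>Only the outer time is confined to \<open>{a..b}\<close>; the inner time may reach back
  to \<open>max 0 (a - T)\<close>. The sign is opposite to that of the exponent
  \<open>Zexp\<close>.\<close>

definition Phi :: "(real \<Rightarrow> complex) \<Rightarrow> real \<Rightarrow> real \<Rightarrow> real \<Rightarrow> (real \<Rightarrow> int \<times> int) \<Rightarrow> complex" where
  "Phi et T a b G = (LINT p:strip T a b|lborel. kern et G (fst p) (snd p))"

definition concat_path :: "real \<Rightarrow> (real \<Rightarrow> int \<times> int) \<Rightarrow> (real \<Rightarrow> int \<times> int) \<Rightarrow> real \<Rightarrow> int \<times> int" where
  "concat_path t g h x = (if x < t then g x else h (x - t))"

lemma spin_path_measurable [measurable_dest]: "spin_path G \<Longrightarrow> G \<in> borel \<rightarrow>\<^sub>M count_space UNIV"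
  by (simp add: spin_path_def)

lemma spin_path_in_spins: "spin_path G \<Longrightarrow> G x \<in> spins \<times> spins"
  by (auto simp: spin_path_def)

lemma spin_path_abs_le: "spin_path G \<Longrightarrow> \<bar>fst (G x)\<bar> \<le> 1 \<and> \<bar>snd (G x)\<bar> \<le> 1"
  using spin_path_in_spins[of G x] by (auto simp: spins_def)

lemma norm_pc_le: "spin_path G \<Longrightarrow> norm (pc G x) \<le> 1"
  using spin_path_abs_le[of G x] by (simp add: pc_def flip: of_int_abs)

lemma norm_mc_le: "spin_path G \<Longrightarrow> norm (mc G x) \<le> 1"
  using spin_path_abs_le[of G x] by (simp add: mc_def flip: of_int_abs)

lemma measurable_pc [measurable]:
  assumes "spin_path G" shows "pc G \<in> borel_measurable borel"
proof -
  note [measurable] = spin_path_measurable[OF assms]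
  show ?thesis unfolding pc_def by measurable
qed

lemma measurable_mc [measurable]:
  assumes "spin_path G" shows "mc G \<in> borel_measurable borel"
proof -
  note [measurable] = spin_path_measurable[OF assms]
  show ?thesis unfolding mc_def by measurable
qed

lemma spin_path_concat: "spin_path g \<Longrightarrow> spin_path h \<Longrightarrow> spin_path (concat_path t g h)"
proof -
  assume g: "spin_path g" and h: "spin_path h"
  note [measurable] = spin_path_measurable[OF g] spin_path_measurable[OF h]
  have "concat_path t g h \<in> borel \<rightarrow>\<^sub>M count_space UNIV"
    unfolding concat_path_def by measurable
  then show ?thesis
    using g h by (auto simp: spin_path_def concat_path_def image_subset_iff)
qed

lemma spin_path_shift: "spin_path h \<Longrightarrow> spin_path (\<lambda>x. h (x - a))"
proof -
  assume h: "spin_path h"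
  note [measurable] = spin_path_measurable[OF h]
  have "(\<lambda>x. h (x - a)) \<in> borel \<rightarrow>\<^sub>M count_space UNIV" by measurable
  then show ?thesis using h by (auto simp: spin_path_def)
qed

lemma integral_shift_Icc: "integral {a..b} f = integral {a + c..b + c} (\<lambda>x. f (x - c :: real) :: complex)"
  using integral_shift_Icc_real[of a b "\<lambda>x. f (x - c)" c]
  by (simp add: o_def)

text \<open>The spectral form of the bath is forgotten here. \<open>M\<close> bounds
  \<open>et\<close> on \<open>{0..T}\<close>, the range of \<open>x1 - x2\<close> on a
  strip.\<close>

locale bath =
  fixes et :: "real \<Rightarrow> complex" and T M :: real
  assumes et_cont: "continuous_on UNIV et"
    and T_pos: "T > 0"
    and et_bound: "\<And>s. s \<in> {0..T} \<Longrightarrow> norm (et s) \<le> M"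
begin

section \<open>Bounds, measurability and additivity of the influence functional\<close>

lemma measurable_et [measurable]: "et \<in> borel_measurable borel"
  using et_cont by (rule borel_measurable_continuous_onI)

lemma M_nonneg: "M \<ge> 0"
  using et_bound[of 0] T_pos order_trans[OF norm_ge_zero[of "et 0"]] by auto

text \<open>The factor 4 is 2 * 2: the difference of two spins has modulus at most 2, and the
  bracket consists of two terms of modulus at most \<open>M\<close>.\<close>

lemma norm_kern_le:
  assumes "spin_path G" "0 \<le> x1 - x2" "x1 - x2 \<le> T"
  shows "norm (kern et G x1 x2) \<le> 4 * M"
proof -
  have e: "norm (et (x1 - x2)) \<le> M" using assms by (intro et_bound) auto
  have "norm (pc G x1 - mc G x1) \<le> 1 + 1"
    by (intro norm_triangle_le_diff add_mono norm_pc_le norm_mc_le assms)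
  moreover have "norm (pc G x2 * et (x1 - x2) - mc G x2 * cnj (et (x1 - x2))) \<le> 1 * M + 1 * M"
    using e M_nonneg by (intro norm_triangle_le_diff add_mono)
       (simp_all only: norm_mult complex_mod_cnj, (intro mult_mono norm_pc_le norm_mc_le assms norm_ge_zero; simp)+)
  ultimately have "norm (kern et G x1 x2) \<le> (1+1) * (1*M + 1*M)"
    unfolding kern_def norm_mult by (intro mult_mono) auto
  then show ?thesis by simp
qed

lemma measurable_kern [measurable]:
  assumes "spin_path G" shows "(\<lambda>p. kern et G (fst p) (snd p)) \<in> borel_measurable borel"
proof -
  note [measurable] = measurable_pc[OF assms] measurable_mc[OF assms]
  have [measurable]: "cnj \<in> borel_measurable borel"
    by (intro borel_measurable_continuous_onI continuous_intros)
  have "(\<lambda>p. kern et G (fst p) (snd p)) \<in> borel_measurable (borel \<Otimes>\<^sub>M borel)"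
    unfolding kern_def by measurable
  then show ?thesis by (simp add: borel_prod)
qed

lemma closed_strip: "closed (strip T a b)"
proof -
  have "strip T a b = {p. a \<le> fst p} \<inter> {p. fst p \<le> b} \<inter> {p. max 0 (fst p - T) \<le> snd p} \<inter> {p. snd p \<le> fst p}"
    by (auto simp: strip_def)
  then show ?thesis by (simp only:) (intro closed_Int closed_Collect_le continuous_intros)
qed

lemma strip_borel [measurable]: "strip T a b \<in> sets borel"
  using closed_strip by (rule borel_closed)

lemma strip_subset: "0 \<le> a \<Longrightarrow> strip T a b \<subseteq> {a..b} \<times> {0..b}"
  by (auto simp: strip_def)

lemma emeasure_square: 
  assumes "A \<in> sets borel" "B \<in> sets borel"
  shows "emeasure lborel (A \<times> B :: (real \<times> real) set) = emeasure lborel A * emeasure lborel B"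
  using assms by (subst lborel_prod[symmetric]) (simp add: lborel.emeasure_pair_measure_Times)

lemma emeasure_strip_finite: "0 \<le> a \<Longrightarrow> emeasure lborel (strip T a b) < \<infinity>"
proof -
  assume "0 \<le> a"
  then have "emeasure lborel (strip T a b) \<le> emeasure lborel ({a..b} \<times> {0..b} :: (real \<times> real) set)"
    by (intro emeasure_mono strip_subset) (auto simp: borel_prod[symmetric])
  also have "\<dots> = emeasure lborel {a..b} * emeasure lborel {0..b}"
    by (rule emeasure_square) auto
  also have "\<dots> < \<infinity>" 
    by (auto simp: emeasure_lborel_Icc_eq ennreal_mult_less_top)
  finally show ?thesis .
qed

lemma strip_kern_le:
  assumes "spin_path G" "p \<in> strip T a b" 
  shows "norm (kern et G (fst p) (snd p)) \<le> 4 * M"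
  using assms by (intro norm_kern_le) (auto simp: strip_def)

lemma kern_set_integrable:
  assumes "spin_path G" "0 \<le> a"
  shows "set_integrable lborel (strip T a b) (\<lambda>p. kern et G (fst p) (snd p))"
  unfolding set_integrable_def
  using assms strip_kern_le[OF assms(1)] emeasure_strip_finite[OF assms(2), of b] measurable_kern[OF assms(1)]
  by (intro integrableI_bounded_set_indicator[where B="4 * M"]) auto

lemma kern_row_integrable:
  assumes G: "spin_path G" and "0 \<le> c" "x1 - T \<le> c" "d \<le> x1"
  shows "set_integrable lborel {c..d} (kern et G x1)"
    "kern et G x1 integrable_on {c..d}"
proof -
  have [measurable]: "cnj \<in> borel_measurable borel"
    by (intro borel_measurable_continuous_onI continuous_intros)
  note [measurable] = measurable_pc[OF G] measurable_mc[OF G]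
  have "kern et G x1 \<in> borel_measurable borel" unfolding kern_def by measurable
  moreover have "emeasure lborel {c..d} < \<infinity>" by (auto simp: emeasure_lborel_Icc_eq)
  ultimately show 1: "set_integrable lborel {c..d} (kern et G x1)"
    unfolding set_integrable_def using assms
    by (intro integrableI_bounded_set_indicator[where B="4 * M"] AE_I2) (auto intro!: norm_kern_le)
  show "kern et G x1 integrable_on {c..d}"
    by (rule set_borel_integral_eq_integral[OF 1])
qed

text \<open>Fubini on the strip. Rows are gauge integrals because \<open>Zexp\<close> is written
  with \<open>integral\<close>; for a bounded measurable kernel on a set of finite area both notions
  of integral agree.\<close>

lemma Phi_iterated:
  fixes a b :: real and ro :: "real \<Rightarrow> complex"
  assumes G: "spin_path G" and a: "0 \<le> a"
  defines "ro \<equiv> \<lambda>x1. integral {max 0 (x1 - T)..x1} (kern et G x1)"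
  shows "set_integrable lborel {a..b} ro" "ro integrable_on {a..b}"
    "Phi et T a b G = integral {a..b} ro"
proof -
  define f where "f = (\<lambda>p. indicator (strip T a b) p *\<^sub>R kern et G (fst p) (snd p))"
  have int: "integrable (lborel \<Otimes>\<^sub>M lborel) f"
    using kern_set_integrable[OF G a, of b] unfolding set_integrable_def f_def lborel_prod .
  have inner: "(\<integral>y. f (x, y) \<partial>lborel) = indicator {a..b} x *\<^sub>R ro x" for x
  proof -
    have "(\<integral>y. f (x, y) \<partial>lborel) = (\<integral>y. indicator {a..b} x *\<^sub>R (indicator {max 0 (x - T)..x} y *\<^sub>R kern et G x y) \<partial>lborel)"
      by (intro Bochner_Integration.integral_cong) (auto simp: f_def strip_def indicator_def)
    also have "\<dots> = indicator {a..b} x *\<^sub>R (LINT y:{max 0 (x - T)..x}|lborel. kern et G x y)"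
      by (simp only: set_lebesgue_integral_def Bochner_Integration.integral_scaleR_right)
    also have "(LINT y:{max 0 (x - T)..x}|lborel. kern et G x y) = ro x"
      unfolding ro_def by (rule set_borel_integral_eq_integral(2)[OF kern_row_integrable(1)[OF G]]) auto
    finally show ?thesis .
  qed
  show 1: "set_integrable lborel {a..b} ro"
    using lborel_pair.integrable_fst'[OF int] unfolding inner set_integrable_def .
  then show "ro integrable_on {a..b}" by (rule set_borel_integral_eq_integral)
  have "Phi et T a b G = integral\<^sup>L (lborel \<Otimes>\<^sub>M lborel) f"
    by (simp add: Phi_def set_lebesgue_integral_def f_def lborel_prod)
  also have "\<dots> = (LINT x:{a..b}|lborel. ro x)"
    using lborel_pair.integral_fst'[OF int] unfolding inner set_lebesgue_integral_def by simp
  also have "\<dots> = integral {a..b} ro"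
    by (rule set_borel_integral_eq_integral[OF 1])
  finally show "Phi et T a b G = integral {a..b} ro" .
qed

lemma Phi_add:
  assumes "spin_path G" "0 \<le> a" "a \<le> b" "b \<le> c"
  shows "Phi et T a c G = Phi et T a b G + Phi et T b c G"
  using Henstock_Kurzweil_Integration.integral_combine[OF assms(3,4) Phi_iterated(2)[OF assms(1,2)]] assms
  by (simp add: Phi_iterated)

text \<open>Finite memory: times before \<open>a - T\<close> are invisible to outer times from
  \<open>a\<close> on. With \<open>a = t + T\<close> the path before t drops out, which makes
  \<open>propag\<close> independent of the history.\<close>

lemma Phi_cong:
  assumes "\<And>x. x \<in> {max 0 (a - T)..b} \<Longrightarrow> G x = G' x"
  shows "Phi et T a b G = Phi et T a b G'"
  unfolding Phi_def
proof (rule set_lebesgue_integral_cong)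
  show "\<forall>p. p \<in> strip T a b \<longrightarrow> kern et G (fst p) (snd p) = kern et G' (fst p) (snd p)"
  proof (intro allI impI)
    fix p assume "p \<in> strip T a b"
    then have "fst p \<in> {max 0 (a - T)..b}" "snd p \<in> {max 0 (a - T)..b}"
      using T_pos by (auto simp: strip_def)
    then show "kern et G (fst p) (snd p) = kern et G' (fst p) (snd p)"
      using assms by (simp add: kern_def pc_def mc_def)
  qed
qed simp

text \<open>The three double integrals tile the strip over \<open>{0..t + T}\<close>: both times in
  the history, outer time in the segment with inner time in the history, and both in the segment,
  the last one after a translation by \<open>t\<close>. For outer times in \<open>{t..t + T}\<close>
  the lower limit \<open>max 0 (x1 - T)\<close> does not exceed \<open>t\<close>, so these rows can
  be split at \<open>t\<close>.\<close>

lemma Zexp_eq_Phi: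
  assumes g: "spin_path g" and h: "spin_path h" and t: "t \<ge> 0"
  shows "Zexp et t T g h = - Phi et T 0 (t + T) (concat_path t g h)"
proof -
  let ?G = "concat_path t g h"
  have G: "spin_path ?G" by (rule spin_path_concat[OF g h])
  define ro where "ro = (\<lambda>x1. integral {max 0 (x1 - T)..x1} (kern et ?G x1))"
  have 1: "integral {0..t} (\<lambda>x1. integral {max 0 (x1 - T)..x1} (\<lambda>x2.
          (pc g x1 - mc g x1) * (pc g x2 * et (x1 - x2) - mc g x2 * cnj (et (x1 - x2)))))
      = integral {0..t} ro"
    unfolding ro_def
  \<comment> \<open>At \<open>x1 = t\<close> the concatenated path already has the value
    \<open>h 0\<close>; this single point is discarded.\<close>
  proof (rule integral_spike[where S="{t}"])
    fix x1 assume "x1 \<in> {0..t} - {t}"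
    then show "integral {max 0 (x1 - T)..x1} (kern et ?G x1) = integral {max 0 (x1 - T)..x1} (\<lambda>x2.
          (pc g x1 - mc g x1) * (pc g x2 * et (x1 - x2) - mc g x2 * cnj (et (x1 - x2))))"
      by (intro Henstock_Kurzweil_Integration.integral_cong)
         (auto simp: kern_def concat_path_def pc_def mc_def)
  qed simp
  define p2 where "p2 = (\<lambda>x1. integral {max 0 (x1 - T)..t} (\<lambda>x2.
          (pc h (x1 - t) - mc h (x1 - t)) * (pc g x2 * et (x1 - x2) - mc g x2 * cnj (et (x1 - x2)))))"
  define p3' where "p3' = (\<lambda>x1. integral {0..x1} (\<lambda>x2.
          (pc h x1 - mc h x1) * (pc h x2 * et (x1 - x2) - mc h x2 * cnj (et (x1 - x2)))))"
  define p3 where "p3 = (\<lambda>x1. p3' (x1 - t))"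
  have p2_eq: "p2 x1 = integral {max 0 (x1 - T)..t} (kern et ?G x1)" if "x1 \<in> {t..t+T}" for x1
    unfolding p2_def
    by (rule integral_spike[where S="{t}"])
       (use that in \<open>auto simp: kern_def concat_path_def pc_def mc_def\<close>)
  have p3_eq: "p3 x1 = integral {t..x1} (kern et ?G x1)" if "x1 \<in> {t..t+T}" for x1
    unfolding p3_def p3'_def
  proof (subst integral_shift_Icc[where c=t], rule Henstock_Kurzweil_Integration.integral_cong[THEN trans])
    show "integral {0 + t..x1 - t + t} (kern et ?G x1) = integral {t..x1} (kern et ?G x1)" by simp
  qed (use that in \<open>auto simp: kern_def concat_path_def pc_def mc_def\<close>)
  have row_eq: "ro x1 = p2 x1 + p3 x1" if "x1 \<in> {t..t+T}" for x1
    unfolding ro_def p2_eq[OF that] p3_eq[OF that]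
    by (rule Henstock_Kurzweil_Integration.integral_combine[symmetric])
       (use that t in \<open>auto intro!: kern_row_integrable G\<close>)
  have p3'_int: "p3' integrable_on {0..T}"
  proof -
    have "p3' x1 = integral {max 0 (x1 - T)..x1} (kern et h x1)" if "x1 \<in> {0..T}" for x1
      using that by (simp add: p3'_def kern_def[abs_def])
    with Phi_iterated(2)[OF h order_refl, of T] show ?thesis
      by (subst integrable_cong) auto
  qed
  have p3_int: "p3 integrable_on {t..t+T}"
    using p3'_int integrable_on_shift_Icc_real[of p3' "-t" t "t+T"] by (simp add: p3_def o_def add.commute)
  have p3_integral: "integral {0..T} p3' = integral {t..t+T} p3"
    unfolding p3_def by (subst integral_shift_Icc[where c=t]) (simp add: add.commute)
  have row_int: "ro integrable_on {t..t+T}"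
    unfolding ro_def by (rule Phi_iterated(2)[OF G t])
  \<comment> \<open>The mixed part is integrable as a difference: the whole row and the translated
    third part are already known to be integrable.\<close>
  have p2_int: "p2 integrable_on {t..t+T}"
    using integrable_diff[OF row_int p3_int] by (subst integrable_cong[where g="\<lambda>x. ro x - p3 x"]) (auto simp: row_eq)
  have "Zexp et t T g h = - integral {0..t} ro - integral {t..t+T} p2 - integral {t..t+T} p3"
    unfolding Zexp_def 1 p2_def[symmetric] p3'_def[symmetric] p3_integral ..
  also have "integral {t..t+T} ro = integral {t..t+T} p2 + integral {t..t+T} p3"
    unfolding Henstock_Kurzweil_Integration.integral_add[OF p2_int p3_int, symmetric]
    by (rule Henstock_Kurzweil_Integration.integral_cong) (rule row_eq)
  then have "- integral {0..t} ro - integral {t..t+T} p2 - integral {t..t+T} p3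
     = - (integral {0..t} ro + integral {t..t+T} ro)" by simp
  also have "integral {0..t} ro + integral {t..t+T} ro = integral {0..t+T} ro"
    using t T_pos Phi_iterated(2)[OF G order_refl, of "t+T"] unfolding ro_def
    by (intro Henstock_Kurzweil_Integration.integral_combine) auto
  also have "\<dots> = Phi et T 0 (t + T) ?G"
    unfolding ro_def by (rule Phi_iterated(3)[OF G order_refl, symmetric])
  finally show ?thesis .
qed

section \<open>Size of the influence functional and its continuity in the path\<close>

lemma norm_Phi_le:
  assumes "spin_path G" "0 \<le> a" "a \<le> b"
  shows "norm (Phi et T a b G) \<le> 4 * M * T * (b - a)"
proof -
  have row: "norm (integral {max 0 (x1 - T)..x1} (kern et G x1)) \<le> 4 * M * T" if "x1 \<in> {a..b}" for x1
  proof -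
    have "norm (integral {max 0 (x1 - T)..x1} (kern et G x1)) \<le> 4 * M * (x1 - max 0 (x1 - T))"
      using that assms T_pos
      using has_integral_bound_real[OF _ finite.emptyI integrable_integral[OF kern_row_integrable(2)[OF assms(1), of "max 0 (x1 - T)" x1 x1]], of "4*M"] norm_kern_le[OF assms(1)] M_nonneg
      by auto
    also have "\<dots> \<le> 4 * M * T"
      using M_nonneg by (intro mult_left_mono) auto
    finally show ?thesis .
  qed
  have "norm (integral {a..b} (\<lambda>x1. integral {max 0 (x1 - T)..x1} (kern et G x1))) \<le> 4 * M * T * (b - a)"
    using has_integral_bound_real[OF _ finite.emptyI integrable_integral[OF Phi_iterated(2)[OF assms(1,2)]], of "4*M*T" b] row assms M_nonneg T_pos
    by auto
  then show ?thesis using assms by (simp add: Phi_iterated)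
qed

text \<open>The kernels agree off the cross formed by \<open>N \<times> {0..b}\<close> and
  \<open>{0..b} \<times> N\<close>. The two arms have total area at most \<open>2 * b * m\<close>,
  and the kernels differ there by at most \<open>8 * M\<close>.\<close>

lemma Phi_diff_le:
  assumes G: "spin_path G" and G': "spin_path G'" and N: "N \<in> sets borel"
    and eq: "\<And>x. x \<in> {0..b} - N \<Longrightarrow> G x = G' x" and Nm: "emeasure lborel N \<le> ennreal m" and b: "0 \<le> b" and m: "0 \<le> m"
  shows "norm (Phi et T 0 b G - Phi et T 0 b G') \<le> 16 * M * b * m"
proof -
  define f where "f G p = indicator (strip T 0 b) p *\<^sub>R kern et G (fst p) (snd p)" for G p
  have i: "integrable lborel (f G)" "integrable lborel (f G')"
    using kern_set_integrable[OF G order_refl, of b] kern_set_integrable[OF G' order_refl, of b] 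
    unfolding set_integrable_def f_def .
  have N2: "N \<times> {0..b} \<in> sets borel" "{0..b} \<times> N \<in> sets borel" 
    using N by (auto simp: borel_prod[symmetric])
  let ?w = "\<lambda>p::real\<times>real. 8 * M * (indicator (N \<times> {0..b}) p + indicator ({0..b} \<times> N) p)"
  have em: "emeasure lborel (N \<times> {0..b}) \<le> ennreal (m * b)" "emeasure lborel ({0..b} \<times> N) \<le> ennreal (m * b)"
    using mult_right_mono[OF Nm, of "ennreal b"] N b m
    by (auto simp: emeasure_square ennreal_mult mult.commute)
  then have fin: "emeasure lborel (N \<times> {0..b}) < \<infinity>" "emeasure lborel ({0..b} \<times> N) < \<infinity>"
    using le_less_trans by fastforce+
  have me: "measure lborel (N \<times> {0..b}) \<le> m * b" "measure lborel ({0..b} \<times> N) \<le> m * b"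
    using em b m unfolding measure_def by (auto intro!: enn2real_leI)
  have iw: "integrable lborel (\<lambda>p::real\<times>real. indicator (N \<times> {0..b}) p :: real)" "integrable lborel (\<lambda>p::real\<times>real. indicator ({0..b} \<times> N) p :: real)"
    using fin N2 by auto
  have "norm (Phi et T 0 b G - Phi et T 0 b G') = norm (\<integral>p. f G p - f G' p \<partial>lborel)"
    unfolding Bochner_Integration.integral_diff[OF i] by (simp add: Phi_def set_lebesgue_integral_def f_def[abs_def])
  also have "\<dots> \<le> (\<integral>p. ?w p \<partial>lborel)"
  proof (rule Bochner_Integration.integral_norm_bound_integral)
    show "integrable lborel (\<lambda>p. f G p - f G' p)" using i by simp
    show "integrable lborel ?w" using iw by simp
    fix p :: "real \<times> real"
    have d: "norm (f G p - f G' p) \<le> 8 * M" 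
    proof (cases "p \<in> strip T 0 b")
      case True
      then have "norm (f G p - f G' p) \<le> 4 * M + 4 * M" unfolding f_def
        using strip_kern_le[OF G True] strip_kern_le[OF G' True] 
        by (intro norm_triangle_le_diff add_mono) auto
      then show ?thesis by simp
    qed (simp add: f_def M_nonneg)
    show "norm (f G p - f G' p) \<le> ?w p"
    proof (cases "p \<in> N \<times> {0..b} \<or> p \<in> {0..b} \<times> N")
      case True
      then have "1 \<le> (indicator (N \<times> {0..b}) p + indicator ({0..b} \<times> N) p :: real)"
        by (auto simp: indicator_def)
      then have "8 * M * 1 \<le> ?w p" using M_nonneg by (intro mult_left_mono) auto
      with d show ?thesis by linarith
    next
      case False
      have "f G p = f G' p"
      proof (cases "p \<in> strip T 0 b")
        case True
        then have "fst p \<in> {0..b}" "snd p \<in> {0..b}" by (auto simp: strip_def)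
        moreover from this False have "fst p \<notin> N" "snd p \<notin> N" by (cases p; auto)+
        ultimately have "G (fst p) = G' (fst p)" "G (snd p) = G' (snd p)" using eq by auto
        then show ?thesis by (simp add: f_def kern_def pc_def mc_def)
      qed (simp add: f_def)
      then show ?thesis using M_nonneg by simp
    qed
  qed
  also have "\<dots> = 8 * M * (measure lborel (N \<times> {0..b}) + measure lborel ({0..b} \<times> N))"
    using iw N2 by simp
  also have "\<dots> \<le> 8 * M * (m * b + m * b)"
    using me M_nonneg by (intro mult_left_mono add_mono) auto
  finally show ?thesis by (simp add: algebra_simps)
qed

end

section \<open>The last jump time and the volume of the simplex\<close>

abbreviation tvec :: "nat \<Rightarrow> (nat \<Rightarrow> real) measure" where
  "tvec n \<equiv> Pi\<^sub>M {..<n} (\<lambda>_. lborel)"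

text \<open>Entry n, counted from 0, is the last waiting time; the pair carries the absolute time
  \<open>fst p\<close> of the last jump instead. This shear of coordinates has Jacobian 1.\<close>

definition last_jump :: "nat \<Rightarrow> real \<times> (nat \<Rightarrow> real) \<Rightarrow> nat \<Rightarrow> real" where
  "last_jump n p = (snd p)(n := fst p - cum (snd p) n)"

lemma measurable_cum [measurable]:
  "k \<le> n \<Longrightarrow> (\<lambda>\<tau>. cum \<tau> k) \<in> borel_measurable (tvec n)"
  unfolding cum_def by measurable

lemma cum_Suc: "cum \<tau> (Suc k) = cum \<tau> k + \<tau> k"
  by (simp add: cum_def)

lemma cum_cong: "(\<And>i. i < k \<Longrightarrow> \<tau> i = \<tau>' i) \<Longrightarrow> cum \<tau> k = cum \<tau>' k"
  by (simp add: cum_def)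

lemma cum_nonneg: "(\<And>i. i < k \<Longrightarrow> 0 \<le> \<tau> i) \<Longrightarrow> 0 \<le> cum \<tau> k"
  by (auto simp: cum_def intro!: sum_nonneg)

lemma cum_last_jump:
  shows "k \<le> n \<Longrightarrow> cum (last_jump n (u, \<tau>)) k = cum \<tau> k"
    and "cum (last_jump n (u, \<tau>)) (Suc n) = u"
proof -
  show *: "cum (last_jump n (u, \<tau>)) k = cum \<tau> k" if "k \<le> n" for k
    using that by (intro cum_cong) (auto simp: last_jump_def)
  show "cum (last_jump n (u, \<tau>)) (Suc n) = u"
    by (simp add: cum_Suc *) (simp add: last_jump_def)
qed

lemma tsimplex_sets [measurable]: "tsimplex L n \<in> sets (tvec n)"
proof -
  have "tsimplex L n = {\<tau> \<in> space (tvec n). (\<forall>k\<in>{..<n}. 0 < \<tau> k) \<and> (n = 0 \<or> cum \<tau> n < L)}"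
    by (auto simp: tsimplex_def space_PiM)
  also have "\<dots> \<in> sets (tvec n)" by measurable
  finally show ?thesis .
qed

lemma tsimplex_mono: "L \<le> L' \<Longrightarrow> tsimplex L n \<subseteq> tsimplex L' n"
  by (auto simp: tsimplex_def)

lemma measurable_last_jump [measurable]: "last_jump n \<in> lborel \<Otimes>\<^sub>M tvec n \<rightarrow>\<^sub>M tvec (Suc n)"
proof -
  have [measurable]: "(\<lambda>p. cum (snd p) n) \<in> borel_measurable (lborel \<Otimes>\<^sub>M tvec n)"
    by (rule measurable_compose[OF measurable_snd measurable_cum]) simp
  have "{..<Suc n} = {..<n} \<union> {n}" by auto
  then show ?thesis unfolding last_jump_def
    by (rule measurable_fun_upd) measurable
qed

lemma last_jump_in_tsimplex:
  \<comment> \<open>The condition \<open>0 < u\<close> is separate because for \<open>n = 0\<close>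
    the simplex is one point whatever its length, so membership of \<tau> does not force it.\<close>
  assumes "\<tau> \<in> space (tvec n)"
  shows "last_jump n (u, \<tau>) \<in> tsimplex L (Suc n) \<longleftrightarrow> 0 < u \<and> u < L \<and> \<tau> \<in> tsimplex u n"
proof -
  have "last_jump n (u, \<tau>) \<in> PiE {..<Suc n} (\<lambda>_. UNIV)"
    using assms by (auto simp: space_PiM last_jump_def PiE_def extensional_def)
  then have "last_jump n (u, \<tau>) \<in> tsimplex L (Suc n) \<longleftrightarrow> (\<forall>k<n. 0 < \<tau> k) \<and> cum \<tau> n < u \<and> u < L"
    by (subst tsimplex_def) (auto simp: cum_last_jump less_Suc_eq, auto simp: last_jump_def)
  moreover have "0 \<le> cum \<tau> n" if "\<forall>k<n. 0 < \<tau> k"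
    using that by (intro cum_nonneg) (auto intro: less_imp_le)
  moreover have "cum \<tau> n = 0" if "n = 0" using that by (simp add: cum_def)
  ultimately show ?thesis using assms by (auto simp: tsimplex_def space_PiM)
qed

lemma pair_sigma_finite_tvec: "pair_sigma_finite lborel (tvec n)"
proof -
  interpret product_sigma_finite "\<lambda>_::nat. lborel :: real measure" by standard
  show ?thesis
    by (intro pair_sigma_finite.intro sigma_finite sigma_finite_lborel) simp
qed

text \<open>For fixed earlier waiting times the map translates the last coordinate by
  \<open>- cum \<tau> n\<close>, which preserves Lebesgue measure; Tonelli does the rest.\<close>

lemma distr_last_jump: "distr (lborel \<Otimes>\<^sub>M tvec n) (tvec (Suc n)) (last_jump n) = tvec (Suc n)"
proof (rule measure_eqI)
  interpret product_sigma_finite "\<lambda>_::nat. lborel :: real measure" by standard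
  interpret P: pair_sigma_finite lborel "tvec n" by (rule pair_sigma_finite_tvec)
  fix A assume "A \<in> sets (distr (lborel \<Otimes>\<^sub>M tvec n) (tvec (Suc n)) (last_jump n))"
  then have A [measurable]: "A \<in> sets (tvec (Suc n))" by simp
  have ins: "{..<Suc n} = insert n {..<n}" by auto
  have "emeasure (distr (lborel \<Otimes>\<^sub>M tvec n) (tvec (Suc n)) (last_jump n)) A
      = (\<integral>\<^sup>+p. indicator A p \<partial>distr (lborel \<Otimes>\<^sub>M tvec n) (tvec (Suc n)) (last_jump n))"
    by simp
  also have "\<dots> = (\<integral>\<^sup>+p. indicator A (last_jump n p) \<partial>(lborel \<Otimes>\<^sub>M tvec n))"
    by (rule nn_integral_distr) measurable
  also have "\<dots> = (\<integral>\<^sup>+\<tau>. \<integral>\<^sup>+u. indicator A (last_jump n (u, \<tau>)) \<partial>lborel \<partial>tvec n)"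
    by (rule P.nn_integral_snd[symmetric, of "\<lambda>p. indicator A (last_jump n p)"]) measurable
  also have "\<dots> = (\<integral>\<^sup>+\<tau>. \<integral>\<^sup>+u. indicator A (\<tau>(n := u)) \<partial>lborel \<partial>tvec n)"
  proof (rule nn_integral_cong)
    fix \<tau> assume \<tau>: "\<tau> \<in> space (tvec n)"
    have "(\<lambda>u. \<tau>(n := u)) \<in> lborel \<rightarrow>\<^sub>M tvec (Suc n)"
      using \<tau> by (intro measurable_fun_upd[where J="{..<n}"]) auto
    then have [measurable]: "(\<lambda>u. \<tau>(n := u)) \<in> borel \<rightarrow>\<^sub>M tvec (Suc n)" by simp
    have "(\<integral>\<^sup>+u. indicator A (\<tau>(n := u)) \<partial>lborel) = 1 * (\<integral>\<^sup>+u. indicator A (\<tau>(n := (- cum \<tau> n + 1 * u))) \<partial>lborel)"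
      by (subst nn_integral_real_affine[where c=1 and t="- cum \<tau> n"]) (auto simp: ennreal_1)
    then show "(\<integral>\<^sup>+u. indicator A (last_jump n (u, \<tau>)) \<partial>lborel) = (\<integral>\<^sup>+u. indicator A (\<tau>(n := u)) \<partial>lborel)"
      by (simp add: last_jump_def)
  qed
  also have "\<dots> = (\<integral>\<^sup>+\<tau>. indicator A \<tau> \<partial>tvec (Suc n))"
    unfolding ins by (rule product_nn_integral_insert[symmetric]) (use A in \<open>auto simp: ins\<close>)
  finally show "emeasure (distr (lborel \<Otimes>\<^sub>M tvec n) (tvec (Suc n)) (last_jump n)) A = emeasure (tvec (Suc n)) A"
    by simp
qed simp

text \<open>The slice at last jump time u is \<open>tsimplex u n\<close>, so the induction step is
  the integral of \<open>u ^ n / fact n\<close> from 0 to L.\<close>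

lemma emeasure_tsimplex: "L > 0 \<Longrightarrow> emeasure (tvec n) (tsimplex L n) = ennreal (L ^ n / fact n)"
proof (induction n arbitrary: L)
  case 0
  have "tsimplex L 0 = space (tvec 0)" by (auto simp: tsimplex_def space_PiM)
  then show ?case by (simp add: PiM_empty)
next
  case (Suc n)
  interpret P: pair_sigma_finite lborel "tvec n" by (rule pair_sigma_finite_tvec)
  have "emeasure (tvec (Suc n)) (tsimplex L (Suc n))
      = (\<integral>\<^sup>+p. indicator (tsimplex L (Suc n)) p \<partial>distr (lborel \<Otimes>\<^sub>M tvec n) (tvec (Suc n)) (last_jump n))"
    by (simp add: distr_last_jump)
  also have "\<dots> = (\<integral>\<^sup>+p. indicator (tsimplex L (Suc n)) (last_jump n p) \<partial>(lborel \<Otimes>\<^sub>M tvec n))"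
    by (rule nn_integral_distr) measurable
  also have "\<dots> = (\<integral>\<^sup>+u. \<integral>\<^sup>+\<tau>. indicator (tsimplex L (Suc n)) (last_jump n (u, \<tau>)) \<partial>tvec n \<partial>lborel)"
    by (rule P.M2.nn_integral_fst[symmetric]) measurable
  also have "\<dots> = (\<integral>\<^sup>+u. ennreal (u ^ n / fact n) * indicator {0..L} u \<partial>lborel)"
  proof (rule nn_integral_cong_AE)
    \<comment> \<open>Both endpoints are removed: the induction hypothesis needs
      \<open>u > 0\<close>, and the slice at \<open>u = L\<close> is empty although the closed
      interval used by the fundamental theorem of calculus contains L.\<close>
    have "AE u in lborel. u \<noteq> 0 \<and> u \<noteq> (L::real)"
      by (intro AE_conjI AE_lborel_singleton)
    then show "AE u in lborel. (\<integral>\<^sup>+\<tau>. indicator (tsimplex L (Suc n)) (last_jump n (u, \<tau>)) \<partial>tvec n)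
       = ennreal (u ^ n / fact n) * indicator {0..L} u"
    proof eventually_elim
      case (elim u)
      have "(\<integral>\<^sup>+\<tau>. indicator (tsimplex L (Suc n)) (last_jump n (u, \<tau>)) \<partial>tvec n)
         = (\<integral>\<^sup>+\<tau>. indicator {0..L} u * indicator (tsimplex u n) \<tau> \<partial>tvec n)"
        using elim by (intro nn_integral_cong) (auto simp: indicator_def last_jump_in_tsimplex)
      also have "\<dots> = indicator {0..L} u * emeasure (tvec n) (tsimplex u n)"
        by (subst nn_integral_cmult) auto
      also have "\<dots> = ennreal (u ^ n / fact n) * indicator {0..L} u"
        using elim Suc.IH[of u] by (auto simp: indicator_def)
      finally show ?case .
    qed
  qed
  also have "\<dots> = ennreal (L ^ Suc n / fact (Suc n) - 0 ^ Suc n / fact (Suc n))"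
  proof (rule nn_integral_FTC_Icc)
    fix x :: real
    have "((\<lambda>u. u ^ Suc n / fact (Suc n)) has_real_derivative (1 + real n) * x ^ n / fact (Suc n)) (at x)"
      using DERIV_cdivide[OF DERIV_pow[of "Suc n" x], of "fact (Suc n)"] by simp
    also have "(1 + real n) * x ^ n / fact (Suc n) = x ^ n / fact n"
      by (simp add: divide_simps)
    finally show "((\<lambda>u. u ^ Suc n / fact (Suc n)) has_real_derivative x ^ n / fact n) (at x)" .
  qed (use Suc.prems in auto)
  finally show ?case by simp
qed

lemma measure_tsimplex: "L > 0 \<Longrightarrow> measure (tvec n) (tsimplex L n) = L ^ n / fact n"
  by (simp add: measure_def emeasure_tsimplex)

lemma measure_tsimplex_diff:
  assumes "0 < t" "t \<le> u"
  shows "measure (tvec n) (tsimplex u n - tsimplex t n) = (u ^ n - t ^ n) / fact n"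
  using assms
  by (subst measure_Diff) (auto simp: measure_tsimplex emeasure_tsimplex diff_divide_distrib dest: subsetD[OF tsimplex_mono])

text \<open>\<open>A\<close> is kept apart from the simplex so that shells
  \<open>tsimplex u n - tsimplex t n\<close> are covered as well.\<close>

lemma bounded_set_integrable_tsimplex:
  fixes f :: "(nat \<Rightarrow> real) \<Rightarrow> complex"
  assumes "f \<in> borel_measurable (tvec n)" "\<And>\<tau>. \<tau> \<in> tsimplex L n \<Longrightarrow> norm (f \<tau>) \<le> B" 
    and A: "A \<subseteq> tsimplex L n" "A \<in> sets (tvec n)" and L: "L > 0"
  shows "set_integrable (tvec n) A f"
    "norm (LINT \<tau>:A|tvec n. f \<tau>) \<le> B * measure (tvec n) A"
proof -
  have fin: "emeasure (tvec n) A < \<infinity>"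
    using emeasure_mono[OF A(1), of "tvec n"] emeasure_tsimplex[OF L, of n] le_less_trans
    by fastforce
  show 1: "set_integrable (tvec n) A f"
    unfolding set_integrable_def using assms fin
    by (intro integrableI_bounded_set_indicator[where B=B] AE_I2) auto
  have "norm (LINT \<tau>:A|tvec n. f \<tau>) \<le> (\<integral>\<tau>. B * indicator A \<tau> \<partial>tvec n)"
    unfolding set_lebesgue_integral_def
  proof (rule order_trans[OF integral_norm_bound integral_mono])
    show "integrable (tvec n) (\<lambda>\<tau>. B * indicat_real A \<tau>)" using A fin by simp
    show "norm (indicat_real A \<tau> *\<^sub>R f \<tau>) \<le> B * indicat_real A \<tau>" for \<tau>
      using assms by (auto simp: indicator_def)
  qed (use integrable_norm[OF 1[unfolded set_integrable_def]] in simp)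
  then show "norm (LINT \<tau>:A|tvec n. f \<tau>) \<le> B * measure (tvec n) A"
    using A by simp
qed

text \<open>The shell between the two simplices consists of the time vectors whose last jump lies in
  \<open>{a..<b}\<close>; \<open>last_jump\<close> and Fubini turn its integral into one over the
  last jump time.\<close>

lemma tsimplex_diff_last_jump:
  fixes f :: "(nat \<Rightarrow> real) \<Rightarrow> complex"
  assumes f: "set_integrable (tvec (Suc n)) (tsimplex b (Suc n)) f" and f': "f \<in> borel_measurable (tvec (Suc n))" 
    and a: "0 < a" "a \<le> b"
  shows "set_integrable lborel {a..<b} (\<lambda>u. LINT \<tau>:tsimplex u n|tvec n. f (last_jump n (u, \<tau>)))"
    and "(LINT \<tau>:tsimplex b (Suc n)|tvec (Suc n). f \<tau>) - (LINT \<tau>:tsimplex a (Suc n)|tvec (Suc n). f \<tau>) =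
      (LINT u:{a..<b}|lborel. LINT \<tau>:tsimplex u n|tvec n. f (last_jump n (u, \<tau>)))"
proof -
  interpret P: pair_sigma_finite lborel "tvec n" by (rule pair_sigma_finite_tvec)
  note [measurable] = f'
  define S where "S = tsimplex b (Suc n) - tsimplex a (Suc n)"
  have S [measurable]: "S \<in> sets (tvec (Suc n))" by (simp add: S_def)
  define g where "g = (\<lambda>\<tau>. indicator S \<tau> *\<^sub>R f \<tau>)"
  have g [measurable]: "g \<in> borel_measurable (tvec (Suc n))"
    unfolding g_def by measurable
  have fS: "set_integrable (tvec (Suc n)) S f"
    by (rule set_integrable_subset[OF f]) (auto simp: S_def)
  then have "integrable (distr (lborel \<Otimes>\<^sub>M tvec n) (tvec (Suc n)) (last_jump n)) g"
    by (simp add: distr_last_jump set_integrable_def g_def)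
  then have int: "integrable (lborel \<Otimes>\<^sub>M tvec n) (\<lambda>p. g (last_jump n p))"
    by (subst (asm) integrable_distr_eq) auto
  have inner: "(\<integral>\<tau>. g (last_jump n (u, \<tau>)) \<partial>tvec n)
     = indicator {a..<b} u *\<^sub>R (LINT \<tau>:tsimplex u n|tvec n. f (last_jump n (u, \<tau>)))" for u
  proof -
    have "(\<integral>\<tau>. g (last_jump n (u, \<tau>)) \<partial>tvec n)
       = (\<integral>\<tau>. indicator {a..<b} u *\<^sub>R (indicator (tsimplex u n) \<tau> *\<^sub>R f (last_jump n (u, \<tau>))) \<partial>tvec n)"
      using a by (intro Bochner_Integration.integral_cong) (auto simp: g_def S_def indicator_def last_jump_in_tsimplex)
    then show ?thesis by (simp only: set_lebesgue_integral_def Bochner_Integration.integral_scaleR_right)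
  qed
  show "set_integrable lborel {a..<b} (\<lambda>u. LINT \<tau>:tsimplex u n|tvec n. f (last_jump n (u, \<tau>)))"
    using P.integrable_fst'[OF int] unfolding inner set_integrable_def .
  have sub: "tsimplex a (Suc n) \<subseteq> tsimplex b (Suc n)" using a by (intro tsimplex_mono)
  have "(LINT \<tau>:tsimplex b (Suc n)|tvec (Suc n). f \<tau>) = (LINT \<tau>:tsimplex a (Suc n) \<union> S|tvec (Suc n). f \<tau>)"
    using sub by (simp add: S_def Un_absorb1)
  also have "\<dots> = (LINT \<tau>:tsimplex a (Suc n)|tvec (Suc n). f \<tau>) + (LINT \<tau>:S|tvec (Suc n). f \<tau>)"
    by (intro set_integral_Un fS set_integrable_subset[OF f] sub) (auto simp: S_def)
  finally have "(LINT \<tau>:tsimplex b (Suc n)|tvec (Suc n). f \<tau>) - (LINT \<tau>:tsimplex a (Suc n)|tvec (Suc n). f \<tau>)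
     = (\<integral>\<tau>. g \<tau> \<partial>distr (lborel \<Otimes>\<^sub>M tvec n) (tvec (Suc n)) (last_jump n))"
    by (simp add: distr_last_jump set_lebesgue_integral_def g_def)
  also have "\<dots> = (\<integral>p. g (last_jump n p) \<partial>(lborel \<Otimes>\<^sub>M tvec n))"
    by (rule integral_distr) measurable
  also have "\<dots> = (\<integral>u. \<integral>\<tau>. g (last_jump n (u, \<tau>)) \<partial>tvec n \<partial>lborel)"
    using P.integral_fst'[OF int] by simp
  finally show "(LINT \<tau>:tsimplex b (Suc n)|tvec (Suc n). f \<tau>) - (LINT \<tau>:tsimplex a (Suc n)|tvec (Suc n). f \<tau>) =
      (LINT u:{a..<b}|lborel. LINT \<tau>:tsimplex u n|tvec n. f (last_jump n (u, \<tau>)))"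
    unfolding inner set_lebesgue_integral_def .
qed

section \<open>Path segments and their weights\<close>

text \<open>Unlike \<open>seg\<close> this takes the jump times themselves, in any order, so a
  translated path has the same form with a constant added to every jump time.\<close>

definition step_path :: "int \<times> int \<Rightarrow> sign list \<Rightarrow> (nat \<Rightarrow> real) \<Rightarrow> real \<Rightarrow> int \<times> int" where
  "step_path r0 sg a x = states r0 sg (card {k \<in> {1..length sg}. a k \<le> x})"

definition jumpfac :: "(int \<Rightarrow> int \<Rightarrow> complex) \<Rightarrow> sign \<Rightarrow> int \<times> int \<Rightarrow> complex" where
  "jumpfac H s r = flipfac H r [s] 1"

text \<open>For \<open>D = 0\<close> the segment is constant and a delay does nothing to it, in line
  with the convention of a vanishing derivative in the first waiting time.\<close>

definition stretch :: "nat \<Rightarrow> real \<Rightarrow> (nat \<Rightarrow> real) \<Rightarrow> nat \<Rightarrow> real" where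
  "stretch D e \<tau> = (if D = 0 then \<tau> else \<tau>(0 := \<tau> 0 + e))"

lemma seg_eq_step_path: "seg r0 sg \<tau> = step_path r0 sg (cum \<tau>)"
  by (simp add: fun_eq_iff seg_def step_path_def)

lemma flipst_flipst [simp]: "flipst s (flipst s r) = r"
  by (cases s; cases r) (simp_all add: flipst_def)

lemma flipst_in_spins: "r \<in> spins \<times> spins \<Longrightarrow> flipst s r \<in> spins \<times> spins"
  by (cases s; cases r) (auto simp: flipst_def spins_def)

lemma states_0 [simp]: "states r0 sg 0 = r0"
  by (simp add: states_def)

lemma states_Nil [simp]: "states r0 [] j = r0"
  by (simp add: states_def)

lemma states_Cons [simp]: "states r0 (s # sg) (Suc j) = states (flipst s r0) sg j"
  by (simp add: states_def)

lemma states_append: "j \<le> length sg \<Longrightarrow> states r0 (sg @ sg') j = states r0 sg j"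
  by (simp add: states_def)

lemma states_snoc [simp]: 
  "states r0 (sg @ [s]) (Suc (length sg)) = flipst s (states r0 sg (length sg))"
  by (simp add: states_def)

lemma states_in_spins: "r0 \<in> spins \<times> spins \<Longrightarrow> states r0 sg j \<in> spins \<times> spins"
proof (induction sg arbitrary: r0 j)
  case (Cons s sg)
  then show ?case by (cases j) (auto simp: flipst_in_spins simp del: mem_Times_iff)
qed simp

lemma flipfac_eq_jumpfac:
  "j < length sg \<Longrightarrow> flipfac H r0 sg (Suc j) = jumpfac H (sg ! j) (states r0 sg j)"
proof -
  assume j: "j < length sg"
  then have "states r0 sg (Suc j) = flipst (sg ! j) (states r0 sg j)"
    by (simp add: states_def take_Suc_conv_app_nth)
  then show ?thesis
    by (simp add: flipfac_def jumpfac_def flipst_def states_def split: sign.split)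
qed

lemma jumpfac_def': "jumpfac H s r = (case s of
      Pl \<Rightarrow> - \<i> * H (fst (flipst s r)) (fst r) | Mi \<Rightarrow> \<i> * H (snd r) (snd (flipst s r)))"
  by (simp add: flipfac_def jumpfac_def states_def split: sign.split)

lemma Yw_alt: "Yw H L r0 sg \<tau> =
     (\<Prod>j\<le>length sg. exp (- \<i> * energy H (states r0 sg j) * complex_of_real (piecelen L (length sg) \<tau> j)))
     * (\<Prod>j<length sg. jumpfac H (sg ! j) (states r0 sg j))"
proof -
  have "(\<Prod>j\<in>{1..length sg}. flipfac H r0 sg j) = (\<Prod>j<length sg. flipfac H r0 sg (Suc j))"
    by (rule prod.reindex_bij_witness[of _ Suc "\<lambda>j. j - 1"]) auto
  then show ?thesis by (simp add: Yw_def flipfac_eq_jumpfac atLeast0AtMost cong: prod.cong_simp)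
qed

lemma Yw_last_jump:
  assumes n: "length sg = n"
  shows "Yw H L r0 (sg @ [s]) (last_jump n (u, \<tau>)) =
    Yw H u r0 sg \<tau> * jumpfac H s (states r0 sg n) * exp (- \<i> * energy H (flipst s (states r0 sg n)) * complex_of_real (L - u))"
proof -
  have 1: "piecelen L (Suc n) (last_jump n (u, \<tau>)) j = piecelen u n \<tau> j" if "j \<le> n" for j
    using that by (auto simp: piecelen_def last_jump_def)
  have 2: "piecelen L (Suc n) (last_jump n (u, \<tau>)) (Suc n) = L - u"
    by (simp add: piecelen_def cum_last_jump)
  have 3: "states r0 (sg @ [s]) (Suc n) = flipst s (states r0 sg n)"
    using states_snoc[of r0 sg s] n by simp
  show ?thesis
    by (simp add: Yw_alt n 1 2 3 states_append nth_append cong: prod.cong_simp)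
qed

lemma Yw_shift:
  "Yw H (L + e) r0 sg \<tau> = Yw H L r0 sg \<tau> * exp (- \<i> * energy H (states r0 sg (length sg)) * complex_of_real e)"
proof -
  let ?n = "length sg"
  have p: "{..?n} = insert ?n {..<?n}" by auto
  have 1: "exp (- \<i> * energy H (states r0 sg ?n) * complex_of_real (piecelen (L + e) ?n \<tau> ?n))
    = exp (- \<i> * energy H (states r0 sg ?n) * complex_of_real (piecelen L ?n \<tau> ?n)) 
      * exp (- \<i> * energy H (states r0 sg ?n) * complex_of_real e)"
    by (simp add: piecelen_def algebra_simps flip: exp_add)
  have 2: "piecelen (L + e) ?n \<tau> j = piecelen L ?n \<tau> j" if "j < ?n" for j
    using that by (simp add: piecelen_def)
  show ?thesis unfolding Yw_alt p
    using 1 by (simp add: 2 cong: prod.cong_simp)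
qed

section \<open>Weights of delayed segments and of segments with a jump at time zero\<close>

lemma cum_stretch: "D \<noteq> 0 \<Longrightarrow> k \<ge> 1 \<Longrightarrow> cum (stretch D e \<tau>) k = cum \<tau> k + e"
proof -
  assume "D \<noteq> 0" "k \<ge> 1"
  moreover from this obtain m where m: "k = Suc m" by (cases k) auto
  ultimately show ?thesis
    unfolding cum_def m stretch_def by (simp add: sum.lessThan_Suc_shift del: sum.lessThan_Suc)
qed

text \<open>Delaying all jumps by \<open>e\<close> lengthens the first piece and shortens the last
  one by the same amount, so a phase of the initial state is exchanged for a phase of the final
  state. For \<open>D = 0\<close> both pieces are the same.\<close>

lemma Yw_stretch:
  assumes D: "length sg = D"
  shows "Yw H L r0 sg \<tau> * exp (- \<i> * energy H r0 * complex_of_real e) =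
     Yw H L r0 sg (stretch D e \<tau>) * exp (- \<i> * energy H (states r0 sg D) * complex_of_real e)"
proof (cases D)
  case 0
  then show ?thesis using D by (simp add: stretch_def)
next
  case (Suc m)
  define E where "E j = - \<i> * energy H (states r0 sg j)" for j
  have p: "{..D} = insert 0 (insert D {1..<D})" using Suc by auto
  have "(\<Prod>j\<le>D. exp (E j * complex_of_real (piecelen L D \<tau> j))) * exp (E 0 * complex_of_real e)
     = (\<Prod>j\<le>D. exp (E j * complex_of_real (piecelen L D (stretch D e \<tau>) j))) * exp (E D * complex_of_real e)"
    unfolding p using Suc cum_stretch[of D D e \<tau>]
    by (simp add: piecelen_def stretch_def algebra_simps exp_add exp_diff cong: prod.cong_simp)
  then show ?thesis by (simp add: Yw_alt D E_def)
qed

lemma cum_cons0: "k \<le> D \<Longrightarrow> cum (cons0 D \<tau>) (Suc k) = cum \<tau> k"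
  unfolding cum_def by (subst sum.lessThan_Suc_shift) (auto simp: cons0_def)

text \<open>The leading piece has length 0 and phase 1, so a jump at time zero leaves just its flip
  factor.\<close>

lemma Yw_cons0:
  assumes D: "length sg = D"
  shows "Yw H L r0 (s # sg) (cons0 D \<tau>) = jumpfac H s r0 * Yw H L (flipst s r0) sg \<tau>"
proof -
  have 0: "piecelen L (Suc D) (cons0 D \<tau>) 0 = 0" by (simp add: piecelen_def cons0_def)
  have 1: "piecelen L (Suc D) (cons0 D \<tau>) (Suc j) = piecelen L D \<tau> j" if "j \<le> D" for j
    using that by (auto simp: piecelen_def cum_cons0) (auto simp: cons0_def)
  have 2: "(\<Prod>j\<le>Suc D. exp (- \<i> * energy H (states r0 (s # sg) j) * complex_of_real (piecelen L (Suc D) (cons0 D \<tau>) j)))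
      = (\<Prod>j\<le>D. exp (- \<i> * energy H (states (flipst s r0) sg j) * complex_of_real (piecelen L D \<tau> j)))"
    unfolding prod.atMost_Suc_shift states_Cons 0 states_0
    by (simp cong: prod.cong_simp add: 1)
  have 3: "(\<Prod>j<Suc D. jumpfac H ((s # sg) ! j) (states r0 (s # sg) j))
      = jumpfac H s r0 * (\<Prod>j<D. jumpfac H (sg ! j) (states (flipst s r0) sg j))"
    by (subst prod.lessThan_Suc_shift) simp
  show ?thesis
    unfolding Yw_alt length_Cons D 2 3 by (simp only: mult_ac)
qed

section \<open>Segments as measurable step functions\<close>

lemma measurable_step_path [measurable]: "step_path r0 sg a \<in> borel \<rightarrow>\<^sub>M count_space UNIV"
proof -
  have "(\<lambda>x. card {k. k \<in> {1..length sg} \<and> a k \<le> x}) \<in> borel \<rightarrow>\<^sub>M count_space UNIV"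
    by measurable
  then show ?thesis
    unfolding step_path_def by (rule measurable_compose) simp
qed

lemma spin_path_step_path: "r0 \<in> spins \<times> spins \<Longrightarrow> spin_path (step_path r0 sg a)"
  unfolding spin_path_def image_subset_iff using states_in_spins
  by (auto simp: step_path_def simp del: mem_Times_iff)

lemma spin_path_seg: "r0 \<in> spins \<times> spins \<Longrightarrow> spin_path (seg r0 sg \<tau>)"
  by (simp add: seg_eq_step_path spin_path_step_path del: mem_Times_iff)

lemma measurable_seg [measurable]:
  assumes "length sg = n"
  shows "(\<lambda>p. seg r0 sg (fst p) (snd p)) \<in> tvec n \<Otimes>\<^sub>M borel \<rightarrow>\<^sub>M count_space UNIV"
proof -
  let ?M = "tvec n \<Otimes>\<^sub>M (borel :: real measure)"
  have "{p \<in> space ?M. k \<in> {k \<in> {1..n}. cum (fst p) k \<le> snd p}} \<in> sets ?M" for k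
  proof (cases "k \<in> {1..n}")
    case True
    then have m: "(\<lambda>p. cum (fst p) k) \<in> borel_measurable ?M"
      by (intro measurable_compose[OF measurable_fst measurable_cum]) simp
    show ?thesis using True borel_measurable_le[OF m measurable_snd] by simp
  qed simp
  then have "(\<lambda>p. card {k \<in> {1..n}. cum (fst p) k \<le> snd p}) \<in> ?M \<rightarrow>\<^sub>M count_space UNIV"
    by (rule measurable_card)
  then show ?thesis
    unfolding seg_def assms by (rule measurable_compose) simp
qed

text \<open>The set of jumps made up to time x depends on the choice of jump times only if x lies
  between \<open>a k\<close> and \<open>b k\<close> for some k; N is the union of these
  intervals.\<close>

lemma step_path_diff:
  fixes a b :: "nat \<Rightarrow> real"
  obtains N where "N \<in> sets borel" "emeasure lborel N \<le> ennreal (\<Sum>k=1..length sg. \<bar>a k - b k\<bar>)"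
    "\<And>x. x \<notin> N \<Longrightarrow> step_path r0 sg a x = step_path r0 sg b x"
proof
  let ?N = "\<Union>k\<in>{1..length sg}. {min (a k) (b k)..<max (a k) (b k)}"
  show "?N \<in> sets borel" by simp
  have "emeasure lborel ?N \<le> (\<Sum>k=1..length sg. emeasure lborel {min (a k) (b k)..<max (a k) (b k)})"
    by (intro emeasure_subadditive_finite) auto
  also have "\<dots> = (\<Sum>k=1..length sg. ennreal \<bar>a k - b k\<bar>)"
    by (intro sum.cong) (auto simp: max_def min_def)
  also have "\<dots> = ennreal (\<Sum>k=1..length sg. \<bar>a k - b k\<bar>)"
    by (intro sum_ennreal) auto
  finally show "emeasure lborel ?N \<le> ennreal (\<Sum>k=1..length sg. \<bar>a k - b k\<bar>)" .
  fix x assume "x \<notin> ?N"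
  then have "a k \<le> x \<longleftrightarrow> b k \<le> x" if "k \<in> {1..length sg}" for k
    using that by (force simp: min_def max_def not_le not_less split: if_splits)
  then have "{k \<in> {1..length sg}. a k \<le> x} = {k \<in> {1..length sg}. b k \<le> x}" by blast
  then show "step_path r0 sg a x = step_path r0 sg b x" by (simp add: step_path_def)
qed

lemma cum_mono: "(\<And>i. i < k \<Longrightarrow> 0 \<le> \<tau> i) \<Longrightarrow> j \<le> k \<Longrightarrow> cum \<tau> j \<le> cum \<tau> k"
  unfolding cum_def by (intro sum_mono2) auto

lemma tsimplex_nonneg: "\<tau> \<in> tsimplex L n \<Longrightarrow> i < n \<Longrightarrow> 0 \<le> \<tau> i"
  by (auto simp: tsimplex_def intro: less_imp_le)

lemma tsimplex_cum_le: "\<tau> \<in> tsimplex L n \<Longrightarrow> 1 \<le> k \<Longrightarrow> k \<le> n \<Longrightarrow> cum \<tau> k < L"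
proof -
  assume a: "\<tau> \<in> tsimplex L n" "1 \<le> k" "k \<le> n"
  then have "cum \<tau> k \<le> cum \<tau> n" by (intro cum_mono tsimplex_nonneg)
  also have "\<dots> < L" using a by (auto simp: tsimplex_def)
  finally show ?thesis .
qed

text \<open>Segments are total functions that rest in their initial state to the left of 0.
  Therefore \<open>\<lambda>x. h (x - e)\<close> is the segment that waits e longer before its first
  jump.\<close>

lemma seg_neg: "\<tau> \<in> tsimplex L (length sg) \<Longrightarrow> x < 0 \<Longrightarrow> seg r0 sg \<tau> x = r0"
proof -
  assume a: "\<tau> \<in> tsimplex L (length sg)" "x < 0"
  have "0 \<le> cum \<tau> k" if "k \<le> length sg" for k
    using that by (intro cum_nonneg tsimplex_nonneg[OF a(1)]) auto
  then have "{k \<in> {1..length sg}. cum \<tau> k \<le> x} = {}" using a by force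
  then show ?thesis by (simp only: seg_def card.empty states_0)
qed

lemma seg_final: 
  assumes "\<And>k. 1 \<le> k \<Longrightarrow> k \<le> length sg \<Longrightarrow> cum \<tau> k \<le> x"
  shows "seg r0 sg \<tau> x = states r0 sg (length sg)"
proof -
  have "{k \<in> {1..length sg}. cum \<tau> k \<le> x} = {1..length sg}" using assms by auto
  then show ?thesis by (simp add: seg_def)
qed

lemma seg_last_jump:
  assumes n: "length sg = n" and \<tau>: "\<tau> \<in> tsimplex u n"
  shows "seg r0 (sg @ [s]) (last_jump n (u, \<tau>)) x = (if x < u then seg r0 sg \<tau> x else flipst s (states r0 sg n))"
proof (cases "x < u")
  case True
  have "{k \<in> {1..Suc n}. cum (last_jump n (u, \<tau>)) k \<le> x} = {k \<in> {1..n}. cum \<tau> k \<le> x}"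
    using True by (auto simp: cum_last_jump le_Suc_eq)
  moreover have "card {k \<in> {1..n}. cum \<tau> k \<le> x} \<le> card {1..n}" by (intro card_mono) auto
  ultimately show ?thesis using True n by (simp add: seg_def states_append)
next
  case False
  have "seg r0 (sg @ [s]) (last_jump n (u, \<tau>)) x = states r0 (sg @ [s]) (length (sg @ [s]))"
    by (rule seg_final) (use False tsimplex_cum_le[OF \<tau>] n in \<open>force simp: cum_last_jump le_Suc_eq\<close>)
  then show ?thesis using False states_snoc[of r0 sg s] n by simp
qed

lemma seg_stretch: "seg r0 sg (stretch (length sg) e \<tau>) x = seg r0 sg \<tau> (x - e)"
proof (cases "length sg = 0")
  case False
  then have "{k \<in> {1..length sg}. cum (stretch (length sg) e \<tau>) k \<le> x} = {k \<in> {1..length sg}. cum \<tau> k \<le> x - e}"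
    by (auto simp: cum_stretch)
  then show ?thesis by (simp add: seg_def)
qed (simp add: seg_def)

text \<open>The prepended jump sits at time 0 and has already happened at every
  \<open>x \<ge> 0\<close>; the exponent reads a segment only at such times.\<close>

lemma seg_cons0:
  assumes D: "length sg = D" and x: "0 \<le> x"
  shows "seg r0 (s # sg) (cons0 D \<tau>) x = seg (flipst s r0) sg \<tau> x"
proof -
  have "{k \<in> {1..Suc D}. cum (cons0 D \<tau>) k \<le> x} = insert 1 (Suc ` {k \<in> {1..D}. cum \<tau> k \<le> x})" (is "?L = ?R")
  proof
    show "?L \<subseteq> ?R"
    proof
      fix k assume k: "k \<in> ?L"
      then obtain j where j: "k = Suc j" by (cases k) auto
      with k show "k \<in> ?R" by (cases "j = 0") (auto simp: cum_cons0)
    qed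
    show "?R \<subseteq> ?L" using x by (auto simp: cum_cons0 cum_cons0[of 0, simplified] cum_def[of \<tau> 0])
  qed
  moreover have "1 \<notin> Suc ` {k \<in> {1..D}. cum \<tau> k \<le> x}" by auto
  ultimately have "card {k \<in> {1..Suc D}. cum (cons0 D \<tau>) k \<le> x} = Suc (card {k \<in> {1..D}. cum \<tau> k \<le> x})"
    by (simp add: card_image)
  then show ?thesis by (simp add: seg_def D)
qed

section \<open>Counting and splitting sign lists\<close>

lemma UNIV_sign: "(UNIV :: sign set) = {Pl, Mi}"
  using sign.exhaust by auto

lemma sign_lists: "{l :: sign list. length l = n} = {xs. set xs \<subseteq> {Pl, Mi} \<and> length xs = n}"
  using UNIV_sign by auto

lemma card_sign_lists: "card {l :: sign list. length l = n} = 2 ^ n"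
  unfolding sign_lists by (subst card_lists_length_eq) (simp_all add: numeral_2_eq_2)

text \<open>The sign of the last jump is split off, not the first, since histories are sorted by
  their last jump.\<close>

lemma sum_sign_lists_Suc:
  fixes f :: "sign list \<Rightarrow> complex"
  shows "(\<Sum>sg\<in>{l. length l = Suc n}. f sg) = (\<Sum>s\<in>{Pl, Mi}. \<Sum>sg\<in>{l. length l = n}. f (sg @ [s]))"
proof -
  have "(\<Sum>s\<in>{Pl, Mi}. \<Sum>sg\<in>{l. length l = n}. f (sg @ [s])) = (\<Sum>p\<in>{Pl, Mi} \<times> {l. length l = n}. f (snd p @ [fst p]))"
    by (simp add: sum.cartesian_product case_prod_beta')
  also have "\<dots> = (\<Sum>sg\<in>{l. length l = Suc n}. f sg)"
  proof (rule sum.reindex_bij_witness[of _ "\<lambda>l. (last l, butlast l)" "\<lambda>p. snd p @ [fst p]"])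
    fix l :: "sign list" assume l: "l \<in> {l. length l = Suc n}"
    then have "l \<noteq> []" by auto
    then show "snd (last l, butlast l) @ [fst (last l, butlast l)] = l" by simp
    show "(last l, butlast l) \<in> {Pl, Mi} \<times> {l. length l = n}"
      using l UNIV_sign by auto
  qed auto
  finally show ?thesis ..
qed

section \<open>Histories with a late jump\<close>

text \<open>Mean value inequality on the convex ball \<open>cball 0 B\<close>, where the derivative
  of exp is at most \<open>exp B\<close> in modulus.\<close>

lemma norm_exp_diff_le:
  fixes z w :: complex
  assumes "norm z \<le> B" "norm w \<le> B"
  shows "norm (exp z - exp w) \<le> exp B * norm (z - w)"
proof (rule field_differentiable_bound[where S="cball 0 B"])
  fix x :: complex assume "x \<in> cball 0 B"
  then show "norm (exp x) \<le> exp B" by (intro order_trans[OF norm_exp]) simp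
qed (use assms in \<open>auto intro!: derivative_eq_intros\<close>)

lemma emeasure_lborel_translate:
  fixes N :: "real set"
  assumes [measurable]: "N \<in> sets borel"
  shows "emeasure lborel {x. x - t \<in> N} = emeasure lborel N" "{x. x - t \<in> N} \<in> sets borel"
proof -
  have eq: "{x. x - t \<in> N} = (\<lambda>x. - t + x) -` N \<inter> space lborel" by auto
  have "emeasure lborel N = emeasure (distr lborel borel ((+) (- t))) N"
    by (simp add: lborel_distr_plus)
  also have "\<dots> = emeasure lborel {x. x - t \<in> N}"
    unfolding eq by (rule emeasure_distr) auto
  finally show "emeasure lborel {x. x - t \<in> N} = emeasure lborel N" ..
  have "(\<lambda>x. x - t) -` N \<inter> space borel \<in> sets borel" by measurable
  then show "{x. x - t \<in> N} \<in> sets borel" by (simp add: vimage_def)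
qed

locale spin_bath = bath et T M for et T M +
  fixes H \<rho> :: "int \<Rightarrow> int \<Rightarrow> complex" and C R :: real
  assumes herm: "\<And>a b. a \<in> spins \<Longrightarrow> b \<in> spins \<Longrightarrow> H a b = cnj (H b a)"
    and H_bound: "\<And>a b. a \<in> spins \<Longrightarrow> b \<in> spins \<Longrightarrow> norm (H a b) \<le> C"
    and rho_bound: "\<And>a b. a \<in> spins \<Longrightarrow> b \<in> spins \<Longrightarrow> norm (\<rho> a b) \<le> R"
begin

definition wt :: "real \<Rightarrow> int \<times> int \<Rightarrow> sign list \<Rightarrow> (real \<Rightarrow> int \<times> int) \<Rightarrow> (nat \<Rightarrow> real) \<Rightarrow> complex" where
  "wt L r sg h \<tau> = Xw H \<rho> L r sg \<tau> * exp (Zexp et L T (seg r sg \<tau>) h)"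

definition amp :: "real \<Rightarrow> int \<times> int \<Rightarrow> sign list \<Rightarrow> (real \<Rightarrow> int \<times> int) \<Rightarrow> complex" where
  "amp L r sg h = (LINT \<tau>:tsimplex L (length sg)|tvec (length sg). wt L r sg h \<tau>)"

text \<open>\<open>4 * M\<close> bounds the kernel, \<open>T\<close> the length of a row, and
  \<open>t + T\<close> the range of outer times.\<close>

definition zbound :: "real \<Rightarrow> real" where
  "zbound t = 4 * M * T * (t + T)"

text \<open>A history without a jump in \<open>[t, t + e)\<close> has at time \<open>t + e\<close> the weight \<open>propag\<close> times its
  weight at time \<open>t\<close> with the segment delayed by \<open>e\<close>; \<open>rem\<close> collects all other histories.\<close>

definition propag :: "real \<Rightarrow> real \<Rightarrow> (real \<Rightarrow> int \<times> int) \<Rightarrow> int \<times> int \<Rightarrow> complex" where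
  "propag t e h r = exp (- \<i> * energy H r * complex_of_real e - Phi et T (t + T) (t + T + e) (\<lambda>x. h (x - t - e)))"

definition rem :: "real \<Rightarrow> real \<Rightarrow> int \<times> int \<Rightarrow> sign list \<Rightarrow> (real \<Rightarrow> int \<times> int) \<Rightarrow> complex" where
  "rem t e r sg h = amp (t + e) r sg h - propag t e h (states r sg (length sg)) * amp t r sg (\<lambda>x. h (x - e))"

lemma C_nonneg: "C \<ge> 0"
  using order_trans[OF norm_ge_zero H_bound[of 1 1]] by (simp add: spins_def)

lemma R_nonneg: "R \<ge> 0"
  using order_trans[OF norm_ge_zero rho_bound[of 1 1]] by (simp add: spins_def)

lemma zbound_mono: "t \<le> u \<Longrightarrow> zbound t \<le> zbound u"
  unfolding zbound_def using M_nonneg T_pos by (intro mult_left_mono) auto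

text \<open>Hermiticity makes the diagonal entries real, so evolution between jumps does not change
  the modulus of a weight.\<close>

lemma norm_exp_energy: "r \<in> spins \<times> spins \<Longrightarrow> norm (exp (- \<i> * energy H r * complex_of_real x)) = 1"
proof -
  assume r: "r \<in> spins \<times> spins"
  have "Im (H a a) = 0" if "a \<in> spins" for a
    using arg_cong[OF herm[OF that that], of Im] by simp
  then have "Im (energy H r) = 0" using r by (auto simp: energy_def)
  then show ?thesis by (simp add: norm_exp_eq_Re)
qed

lemma norm_energy_le: "r \<in> spins \<times> spins \<Longrightarrow> norm (energy H r) \<le> 2 * C"
  using norm_triangle_ineq4[of "H (fst r) (fst r)" "H (snd r) (snd r)"]
    H_bound[of "fst r" "fst r"] H_bound[of "snd r" "snd r"]
  by (simp add: energy_def mem_Times_iff)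

lemma norm_jumpfac_le: "r \<in> spins \<times> spins \<Longrightarrow> norm (jumpfac H s r) \<le> C"
  using flipst_in_spins[of r s] H_bound
  by (auto simp: jumpfac_def' norm_mult split: sign.split)

lemma norm_Xw_le: 
  assumes r: "r \<in> spins \<times> spins" 
  shows "norm (Xw H \<rho> L r sg \<tau>) \<le> R * C ^ length sg"
proof -
  have "norm (Yw H L r sg \<tau>) \<le> C ^ length sg"
    unfolding Yw_alt norm_mult prod_norm[symmetric] norm_exp_energy[OF states_in_spins[OF r]]
    using prod_mono[of "{..<length sg}" "\<lambda>j. norm (jumpfac H (sg ! j) (states r sg j))" "\<lambda>_. C"]
      norm_jumpfac_le[OF states_in_spins[OF r]] by simp
  then show ?thesis
    unfolding Xw_def norm_mult using r rho_bound R_nonneg C_nonneg by (intro mult_mono) auto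
qed

lemma norm_Zexp_le:
  assumes "spin_path g" "spin_path h" "0 \<le> t"
  shows "norm (Zexp et t T g h) \<le> zbound t"
  using norm_Phi_le[OF spin_path_concat[OF assms(1,2)], of 0 "t + T" t] assms T_pos
  by (simp add: Zexp_eq_Phi zbound_def)

lemma norm_wt_le:
  assumes r: "r \<in> spins \<times> spins" and h: "spin_path h" and L: "0 \<le> L"
  shows "norm (wt L r sg h \<tau>) \<le> R * C ^ length sg * exp (zbound L)"
  unfolding wt_def norm_mult
  using norm_Xw_le[OF r] R_nonneg C_nonneg norm_Zexp_le[OF spin_path_seg[OF r] h L, of sg \<tau>]
  by (intro mult_mono order_trans[OF norm_exp]) auto

lemma norm_wt_le_mono:
  assumes r: "r \<in> spins \<times> spins" and h: "spin_path h" and L: "0 \<le> L" "L \<le> L'"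
  shows "norm (wt L r sg h \<tau>) \<le> R * C ^ length sg * exp (zbound L')"
  by (rule order_trans[OF norm_wt_le[OF r h L(1)]])
     (use R_nonneg C_nonneg zbound_mono[OF L(2)] in \<open>auto intro: mult_left_mono\<close>)

text \<open>The vector \<tau> enters through a path inside an integral. The kernel is jointly
  measurable in \<tau> and the two times, and integrating out the times preserves measurability in
  \<tau>.\<close>

lemma measurable_wt:
  assumes r: "r \<in> spins \<times> spins" and h: "spin_path h" and L: "0 \<le> L" and n: "length sg = n"
  shows "wt L r sg h \<in> borel_measurable (tvec n)"
proof -
  have [measurable]: "(\<lambda>\<tau>. piecelen L n \<tau> j) \<in> borel_measurable (tvec n)" for j
    unfolding piecelen_def by (cases "j < n") auto
  have X: "Xw H \<rho> L r sg \<in> borel_measurable (tvec n)"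
    unfolding Xw_def Yw_alt n by measurable
  let ?G = "\<lambda>\<tau>. concat_path L (seg r sg \<tau>) h"
  let ?N = "tvec n \<Otimes>\<^sub>M (borel \<Otimes>\<^sub>M borel :: (real \<times> real) measure)"
  note [measurable] = spin_path_measurable[OF h]
  \<comment> \<open>\<open>f\<close> stands for either coordinate of the pair of times, so one
    argument serves both x1 and x2.\<close>
  have G: "(\<lambda>q. ?G (fst q) (f (snd q))) \<in> ?N \<rightarrow>\<^sub>M count_space UNIV"
    if [measurable]: "f \<in> borel \<Otimes>\<^sub>M borel \<rightarrow>\<^sub>M (borel :: real measure)" for f
  proof -
    have [measurable]: "(\<lambda>q. seg r sg (fst q) (f (snd q))) \<in> ?N \<rightarrow>\<^sub>M count_space UNIV"
      using measurable_compose[OF _ measurable_seg[OF n], of "\<lambda>q. (fst q, f (snd q))" ?N r] by simp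
    show ?thesis unfolding concat_path_def by measurable
  qed
  note [measurable] = G[of fst, simplified] G[of snd, simplified]
  have [measurable]: "cnj \<in> borel_measurable borel"
    by (intro borel_measurable_continuous_onI continuous_intros)
  have "(\<lambda>q. kern et (?G (fst q)) (fst (snd q)) (snd (snd q))) \<in> borel_measurable ?N"
    unfolding kern_def pc_def mc_def by measurable
  then have k [measurable]: "(\<lambda>q. kern et (?G (fst q)) (fst (snd q)) (snd (snd q))) \<in> borel_measurable (tvec n \<Otimes>\<^sub>M lborel)"
    by (subst measurable_cong_sets[OF sets_pair_measure_cong[OF refl, of lborel "borel \<Otimes>\<^sub>M borel"] refl])
       (simp_all only: borel_prod sets_lborel)
  have "(\<lambda>q. indicator (strip T 0 (L + T)) (snd q) *\<^sub>R kern et (?G (fst q)) (fst (snd q)) (snd (snd q)))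
     \<in> borel_measurable (tvec n \<Otimes>\<^sub>M lborel)"
    using strip_borel[of 0 "L + T"] by measurable
  then have "(\<lambda>\<tau>. Phi et T 0 (L + T) (?G \<tau>)) \<in> borel_measurable (tvec n)"
    unfolding Phi_def set_lebesgue_integral_def
    by (intro lborel.borel_measurable_lebesgue_integral) (simp add: case_prod_beta')
  then have "(\<lambda>\<tau>. Zexp et L T (seg r sg \<tau>) h) \<in> borel_measurable (tvec n)"
    using Zexp_eq_Phi[OF spin_path_seg[OF r] h L] by simp
  with X show ?thesis unfolding wt_def by measurable
qed

lemma wt_set_integrable:
  assumes r: "r \<in> spins \<times> spins" and h: "spin_path h" and L: "0 \<le> L" and L': "0 < L'"
  shows "set_integrable (tvec (length sg)) (tsimplex L' (length sg)) (wt L r sg h)"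
  by (rule bounded_set_integrable_tsimplex(1)[OF measurable_wt[OF r h L refl] norm_wt_le[OF r h L] _ _ L']) auto

lemma norm_amp_le:
  assumes r: "r \<in> spins \<times> spins" and h: "spin_path h" and L: "0 < L"
  shows "norm (amp L r sg h) \<le> R * C ^ length sg * exp (zbound L) * (L ^ length sg / fact (length sg))"
  using bounded_set_integrable_tsimplex(2)[OF measurable_wt[OF r h _ refl] norm_wt_le[OF r h] order_refl tsimplex_sets L] L
  by (simp add: amp_def measure_tsimplex)

text \<open>Agreement is asked for at nonnegative times, since behind a history of length t the path
  \<open>h\<close> is read at \<open>x - t \<ge> 0\<close>.\<close>

lemma Zexp_diff_path:
  assumes g: "spin_path g" and h: "spin_path h" and h': "spin_path h'" and t: "0 \<le> t"
    and N: "N \<in> sets borel" "emeasure lborel N \<le> ennreal m" "0 \<le> m" "\<And>x. 0 \<le> x \<Longrightarrow> x \<notin> N \<Longrightarrow> h x = h' x"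
  shows "norm (Zexp et t T g h - Zexp et t T g h') \<le> 16 * M * (t + T) * m"
proof -
  have "norm (Phi et T 0 (t + T) (concat_path t g h) - Phi et T 0 (t + T) (concat_path t g h')) \<le> 16 * M * (t + T) * m"
    by (rule Phi_diff_le[where N="{x. x - t \<in> N}"])
       (use N t T_pos emeasure_lborel_translate[OF N(1)] in \<open>auto simp: concat_path_def intro: spin_path_concat g h h'\<close>)
  then show ?thesis using g h h' t by (simp add: Zexp_eq_Phi norm_minus_commute)
qed

lemma amp_diff_path:
  assumes r: "r \<in> spins \<times> spins" and h: "spin_path h" and h': "spin_path h'" and t: "0 < t"
    and N: "N \<in> sets borel" "emeasure lborel N \<le> ennreal m" "0 \<le> m" "\<And>x. 0 \<le> x \<Longrightarrow> x \<notin> N \<Longrightarrow> h x = h' x"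
  shows "norm (amp t r sg h - amp t r sg h')
    \<le> R * C ^ length sg * (exp (zbound t) * (16 * M * (t + T) * m)) * (t ^ length sg / fact (length sg))"
proof -
  let ?n = "length sg"
  have "amp t r sg h - amp t r sg h' = (LINT \<tau>:tsimplex t ?n|tvec ?n. wt t r sg h \<tau> - wt t r sg h' \<tau>)"
    unfolding amp_def using t by (intro set_integral_diff(2)[symmetric] wt_set_integrable r h h') auto
  also have "norm \<dots> \<le> R * C ^ ?n * (exp (zbound t) * (16 * M * (t + T) * m)) * measure (tvec ?n) (tsimplex t ?n)"
  proof (rule bounded_set_integrable_tsimplex(2)[OF _ _ order_refl tsimplex_sets t])
    show "(\<lambda>\<tau>. wt t r sg h \<tau> - wt t r sg h' \<tau>) \<in> borel_measurable (tvec ?n)"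
      using t by (intro borel_measurable_diff measurable_wt r h h') auto
    fix \<tau>
    note s = spin_path_seg[OF r, of sg \<tau>]
    have "norm (exp (Zexp et t T (seg r sg \<tau>) h) - exp (Zexp et t T (seg r sg \<tau>) h'))
       \<le> exp (zbound t) * norm (Zexp et t T (seg r sg \<tau>) h - Zexp et t T (seg r sg \<tau>) h')"
      using t by (intro norm_exp_diff_le norm_Zexp_le s h h') auto
    also have "\<dots> \<le> exp (zbound t) * (16 * M * (t + T) * m)"
      using t by (intro mult_left_mono Zexp_diff_path[OF s h h' _ N]) auto
    finally have e: "norm (exp (Zexp et t T (seg r sg \<tau>) h) - exp (Zexp et t T (seg r sg \<tau>) h')) \<le> exp (zbound t) * (16 * M * (t + T) * m)" .
    have "wt t r sg h \<tau> - wt t r sg h' \<tau> = Xw H \<rho> t r sg \<tau> * (exp (Zexp et t T (seg r sg \<tau>) h) - exp (Zexp et t T (seg r sg \<tau>) h'))"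
      by (simp add: wt_def algebra_simps)
    then show "norm (wt t r sg h \<tau> - wt t r sg h' \<tau>) \<le> R * C ^ ?n * (exp (zbound t) * (16 * M * (t + T) * m))"
      using norm_Xw_le[OF r, of t sg \<tau>] e R_nonneg C_nonneg by (simp only: norm_mult) (intro mult_mono, auto)
  qed
  finally show ?thesis using t by (simp add: measure_tsimplex)
qed

text \<open>The history has made its last jump before t, and left of 0 the segment rests in the
  state where the history ends. Hence the history up to \<open>t + e\<close> followed by
  \<open>h\<close> is the same path as the history up to t followed by the delayed segment.
  Splitting the outer times at \<open>t + T\<close> leaves a strip that sees the delayed segment
  alone.\<close>

lemma Zexp_shift:
  assumes r: "r \<in> spins \<times> spins" and h: "spin_path h" and t: "0 < t" and e: "0 \<le> e" and n: "length sg = n"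
    and \<tau>: "\<tau> \<in> tsimplex t n" and neg: "\<And>x. x < 0 \<Longrightarrow> h x = states r sg n"
  shows "Zexp et (t + e) T (seg r sg \<tau>) h
    = Zexp et t T (seg r sg \<tau>) (\<lambda>x. h (x - e)) - Phi et T (t + T) (t + T + e) (\<lambda>x. h (x - t - e))"
proof -
  let ?g = "seg r sg \<tau>"
  let ?G = "concat_path (t + e) ?g h"
  note g = spin_path_seg[OF r, of sg \<tau>]
  have G: "?G = concat_path t ?g (\<lambda>x. h (x - e))"
  proof
    fix x
    have "?g x = states r sg n" if "t \<le> x"
      using that n tsimplex_cum_le[OF \<tau>] by (subst seg_final) force+
    then show "?G x = concat_path t ?g (\<lambda>x. h (x - e)) x"
      using neg[of "x - t - e"] e by (auto simp: concat_path_def algebra_simps)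
  qed
  have "Zexp et (t + e) T ?g h = - Phi et T 0 (t + e + T) ?G"
    using t e by (intro Zexp_eq_Phi g h) auto
  also have "t + e + T = t + T + e" by simp
  also have "Phi et T 0 (t + T + e) ?G = Phi et T 0 (t + T) ?G + Phi et T (t + T) (t + T + e) ?G"
    using t e T_pos by (intro Phi_add spin_path_concat g h) auto
  also have "Phi et T (t + T) (t + T + e) ?G = Phi et T (t + T) (t + T + e) (\<lambda>x. h (x - t - e))"
    unfolding G by (rule Phi_cong) (use t in \<open>auto simp: concat_path_def algebra_simps\<close>)
  also have "Phi et T 0 (t + T) ?G = - Zexp et t T ?g (\<lambda>x. h (x - e))"
    using t unfolding G by (subst Zexp_eq_Phi) (auto intro: g h spin_path_shift)
  finally show ?thesis by simp
qed

text \<open>The integral runs over \<open>tsimplex t n\<close> while the weight belongs to time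
  \<open>t + e\<close>: these are the histories of length \<open>t + e\<close> that do not jump from
  t on.\<close>

lemma amp_no_late_jump:
  assumes r: "r \<in> spins \<times> spins" and h: "spin_path h" and t: "0 < t" and e: "0 \<le> e" and n: "length sg = n"
    and neg: "\<And>x. x < 0 \<Longrightarrow> h x = states r sg n"
  shows "(LINT \<tau>:tsimplex t n|tvec n. wt (t + e) r sg h \<tau>) = propag t e h (states r sg n) * amp t r sg (\<lambda>x. h (x - e))"
proof -
  have "(LINT \<tau>:tsimplex t n|tvec n. wt (t + e) r sg h \<tau>)
     = (LINT \<tau>:tsimplex t n|tvec n. propag t e h (states r sg n) * wt t r sg (\<lambda>x. h (x - e)) \<tau>)"
  proof (rule set_lebesgue_integral_cong)
    show "\<forall>\<tau>. \<tau> \<in> tsimplex t n \<longrightarrow> wt (t + e) r sg h \<tau> = propag t e h (states r sg n) * wt t r sg (\<lambda>x. h (x - e)) \<tau>"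
      using Zexp_shift[OF r h t e n _ neg] n
      by (auto simp: wt_def Xw_def Yw_shift propag_def exp_diff)
  qed simp
  then show ?thesis by (simp add: amp_def n)
qed

section \<open>The remainder from late jumps: representation, bound and limit\<close>

lemma rem_Nil:
  assumes "r \<in> spins \<times> spins" "spin_path h" "0 < t" "0 \<le> e" "\<And>x. x < 0 \<Longrightarrow> h x = r"
  shows "rem t e r [] h = 0"
proof -
  have "tsimplex (t + e) 0 = tsimplex t 0" by (auto simp: tsimplex_def)
  with amp_no_late_jump[OF assms(1-4), of "[]" 0] assms(5) show ?thesis
    by (simp add: rem_def amp_def)
qed

lemma wt_measurable_last_jump:
  assumes r: "r \<in> spins \<times> spins" and h: "spin_path h" and L: "0 \<le> L" and n: "length sg = Suc n"
  shows "(\<lambda>\<tau>. wt L r sg h (last_jump n (u, \<tau>))) \<in> borel_measurable (tvec n)"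
  by (rule measurable_compose[OF _ measurable_wt[OF r h L n]]) measurable

text \<open>Only the last jump time u is restricted to \<open>{t..<t+e}\<close>; the earlier jumps
  range over \<open>tsimplex u n\<close> and may themselves fall after t.\<close>

lemma rem_snoc:
  assumes r: "r \<in> spins \<times> spins" and h: "spin_path h" and t: "0 < t" and e: "0 \<le> e" and n: "length sg = n"
    and neg: "\<And>x. x < 0 \<Longrightarrow> h x = flipst s (states r sg n)"
  defines "G \<equiv> \<lambda>u. LINT \<tau>:tsimplex u n|tvec n. wt (t + e) r (sg @ [s]) h (last_jump n (u, \<tau>))"
  shows "rem t e r (sg @ [s]) h = (LINT u:{t..<t+e}|lborel. G u)" "set_integrable lborel {t..<t+e} G"
proof -
  have l: "length (sg @ [s]) = Suc n" using n by simp
  have st: "states r (sg @ [s]) (Suc n) = flipst s (states r sg n)" using states_snoc[of r sg s] n by simp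
  have i: "set_integrable (tvec (Suc n)) (tsimplex (t + e) (Suc n)) (wt (t + e) r (sg @ [s]) h)"
    using wt_set_integrable[OF r h, of "t+e" "t+e" "sg @ [s]"] t e n by simp
  have m: "wt (t + e) r (sg @ [s]) h \<in> borel_measurable (tvec (Suc n))"
    using t e by (intro measurable_wt[OF r h _ l]) auto
  show "set_integrable lborel {t..<t+e} G"
    unfolding G_def using t e by (intro tsimplex_diff_last_jump(1)[OF i m t]) auto
  show "rem t e r (sg @ [s]) h = (LINT u:{t..<t+e}|lborel. G u)"
    unfolding G_def using t e tsimplex_diff_last_jump(2)[OF i m t] amp_no_late_jump[OF r h t e l] neg st
    by (simp add: rem_def n amp_def)
qed

lemma norm_set_integral_interval_le:
  fixes G :: "real \<Rightarrow> complex"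
  assumes "set_integrable lborel {a..<b} G" "a \<le> b" "\<And>u. u \<in> {a..<b} \<Longrightarrow> norm (G u) \<le> B"
  shows "norm (LINT u:{a..<b}|lborel. G u) \<le> B * (b - a)"
proof -
  have "norm (LINT u:{a..<b}|lborel. G u) \<le> (\<integral>u. B * indicator {a..<b} u \<partial>lborel)"
    unfolding set_lebesgue_integral_def
  proof (rule Bochner_Integration.integral_norm_bound_integral)
    show "norm (indicat_real {a..<b} u *\<^sub>R G u) \<le> B * indicat_real {a..<b} u" for u
      using assms by (auto simp: indicator_def)
  qed (use assms in \<open>auto simp: set_integrable_def\<close>)
  then show ?thesis using assms by simp
qed

text \<open>Enlarging the time to \<open>t + 1\<close> makes the constant uniform in
  \<open>e \<le> 1\<close>. The bound is linear in e, so after division by e it serves as a majorant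
  for the series over the number of jumps.\<close>

lemma norm_rem_snoc_le:
  assumes r: "r \<in> spins \<times> spins" and h: "spin_path h" and t: "0 < t" and e: "0 \<le> e" "e \<le> 1" and n: "length sg = n"
    and neg: "\<And>x. x < 0 \<Longrightarrow> h x = flipst s (states r sg n)"
  shows "norm (rem t e r (sg @ [s]) h) \<le> R * C ^ Suc n * exp (zbound (t + 1)) * ((t + 1) ^ n / fact n) * e"
proof -
  have l: "length (sg @ [s]) = Suc n" using n by simp
  have "norm (LINT \<tau>:tsimplex u n|tvec n. wt (t + e) r (sg @ [s]) h (last_jump n (u, \<tau>)))
     \<le> R * C ^ Suc n * exp (zbound (t + 1)) * ((t + 1) ^ n / fact n)" if u: "u \<in> {t..<t+e}" for u
  proof -
    have "norm (wt (t + e) r (sg @ [s]) h \<tau>) \<le> R * C ^ Suc n * exp (zbound (t + 1))" for \<tau>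
      using norm_wt_le_mono[OF r h, of "t+e" "t+1" "sg @ [s]" \<tau>] t e n by simp
    then have "norm (LINT \<tau>:tsimplex u n|tvec n. wt (t + e) r (sg @ [s]) h (last_jump n (u, \<tau>)))
      \<le> R * C ^ Suc n * exp (zbound (t + 1)) * measure (tvec n) (tsimplex u n)"
      using t e u by (intro bounded_set_integrable_tsimplex(2)[OF _ _ order_refl] wt_measurable_last_jump r h l) auto
    also have "\<dots> \<le> R * C ^ Suc n * exp (zbound (t + 1)) * ((t + 1) ^ n / fact n)"
      using t e u R_nonneg C_nonneg
      by (subst measure_tsimplex) (auto intro!: mult_left_mono divide_right_mono power_mono mult_nonneg_nonneg)
    finally show ?thesis .
  qed
  from norm_set_integral_interval_le[OF rem_snoc(2)[OF r h t e(1) n neg] _ this] rem_snoc(1)[OF r h t e(1) n neg] e(1)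
  show ?thesis by simp
qed

text \<open>There are two sources of order e. On \<open>{0..t + T}\<close> the concatenated paths
  differ at most on \<open>{t..<t+e}\<close> and, since every jump of \<open>h\<close> is moved by
  e, on a further set of measure at most \<open>length sh * e\<close>. The outer times beyond
  \<open>t + T\<close> add a strip of width e whose rows have length at most T.\<close>

lemma Zexp_last_jump_diff:
  assumes r: "r \<in> spins \<times> spins" and h: "spin_path h" and t: "0 < t" and n: "length sg = n"
    and u: "t \<le> u" "u < t + e" and \<tau>: "\<tau> \<in> tsimplex u n" and q: "q \<in> spins \<times> spins"
    and h_eq: "h = step_path q sh a"
  shows "norm (Zexp et (t + e) T (seg r (sg @ [s]) (last_jump n (u, \<tau>))) h - Zexp et t T (seg r sg \<tau>) h)
     \<le> (16 * M * (t + T) * (1 + real (length sh)) + 4 * M * T) * e"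
proof -
  let ?g = "seg r sg \<tau>" and ?g' = "seg r (sg @ [s]) (last_jump n (u, \<tau>))"
  let ?G = "concat_path t ?g h" and ?G' = "concat_path (t + e) ?g' h"
  note g = spin_path_seg[OF r, of sg \<tau>] and g' = spin_path_seg[OF r, of "sg @ [s]" "last_jump n (u, \<tau>)"]
  note G = spin_path_concat[OF g h, of t] and G' = spin_path_concat[OF g' h, of "t+e"]
  have e: "0 \<le> e" using u by simp
  obtain N where N: "N \<in> sets borel" 
    "emeasure lborel N \<le> ennreal (\<Sum>k=1..length sh. \<bar>(a k + (t + e)) - (a k + t)\<bar>)"
    "\<And>x. x \<notin> N \<Longrightarrow> step_path q sh (\<lambda>k. a k + (t + e)) x = step_path q sh (\<lambda>k. a k + t) x"
    by (rule step_path_diff[of "\<lambda>k. a k + (t + e)" "\<lambda>k. a k + t" sh q]) blast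
  have sh: "h (x - d) = step_path q sh (\<lambda>k. a k + d) x" for x d
    unfolding h_eq by (simp add: step_path_def algebra_simps)
  have N2: "emeasure lborel N \<le> ennreal (real (length sh) * e)" using N(2) e by simp
  let ?N' = "{t..<t+e} \<union> N"
  have N': "?N' \<in> sets borel" using N(1) by simp
  have "emeasure lborel ?N' \<le> emeasure lborel {t..<t+e} + emeasure lborel N"
    using N(1) by (intro emeasure_subadditive) auto
  also have "\<dots> \<le> ennreal e + ennreal (real (length sh) * e)"
    using e by (intro add_mono N2) simp
  also have "\<dots> = ennreal ((1 + real (length sh)) * e)"
    using e by (subst ennreal_plus[symmetric]) (auto simp: algebra_simps)
  finally have mN': "emeasure lborel ?N' \<le> ennreal ((1 + real (length sh)) * e)" .
  have eq: "?G' x = ?G x" if "x \<in> {0..t + T} - ?N'" for x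
  proof (cases "x < t")
    case True
    then have "x < u" using u by simp
    then show ?thesis using True e seg_last_jump[OF n \<tau>, of r s x] by (simp add: concat_path_def)
  next
    case False
    then have "h (x - (t + e)) = h (x - t)" using that N(3)[of x] by (simp only: sh) auto
    then show ?thesis using False that by (auto simp: concat_path_def)
  qed
  have 1: "norm (Phi et T 0 (t + T) ?G' - Phi et T 0 (t + T) ?G) \<le> 16 * M * (t + T) * ((1 + real (length sh)) * e)"
    using t T_pos e by (intro Phi_diff_le[OF G' G N' eq mN']) auto
  have 2: "norm (Phi et T (t + T) (t + T + e) ?G') \<le> 4 * M * T * (t + T + e - (t + T))"
    using t T_pos e by (intro norm_Phi_le G') auto
  have "Phi et T 0 (t + e + T) ?G' = Phi et T 0 (t + T) ?G' + Phi et T (t + T) (t + T + e) ?G'"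
    using Phi_add[OF G', of 0 "t + T" "t + T + e"] t T_pos e by (simp add: algebra_simps)
  then have "Zexp et (t + e) T ?g' h - Zexp et t T ?g h
    = - (Phi et T 0 (t + T) ?G' - Phi et T 0 (t + T) ?G) - Phi et T (t + T) (t + T + e) ?G'"
    using t e g g' h by (simp add: Zexp_eq_Phi)
  also have "norm \<dots> \<le> 16 * M * (t + T) * ((1 + real (length sh)) * e) + 4 * M * T * (t + T + e - (t + T))"
    using 1 2 by (intro norm_triangle_le_diff add_mono) (simp_all only: norm_minus_cancel)
  finally show ?thesis by (simp add: algebra_simps)
qed

text \<open>\<open>4 * C\<close> pays for the phases of the states before and after the late jump,
  whose energies are at most \<open>2 * C\<close> each; the other terms come from
  \<open>Zexp_last_jump_diff\<close>.\<close>

definition lipc :: "real \<Rightarrow> nat \<Rightarrow> real" where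
  "lipc t D = 4 * C + 16 * M * (t + T) * (1 + real D) + 4 * M * T"

lemma wt_last_jump_diff:
  assumes r: "r \<in> spins \<times> spins" and h: "spin_path h" and t: "0 < t" and n: "length sg = n" and e: "e \<le> 1"
    and u: "t \<le> u" "u < t + e" and \<tau>: "\<tau> \<in> tsimplex u n" and q: "q \<in> spins \<times> spins"
    and h_eq: "h = step_path q sh a"
  shows "norm (wt (t + e) r (sg @ [s]) h (last_jump n (u, \<tau>)) - jumpfac H s (states r sg n) * wt t r sg h \<tau>)
     \<le> R * C ^ Suc n * (exp (4 * C + zbound (t + 1)) * (lipc t (length sh) * e))"
proof -
  define r' where "r' = states r sg n"
  define r'' where "r'' = flipst s r'"
  have r': "r' \<in> spins \<times> spins" "r'' \<in> spins \<times> spins"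
    using states_in_spins[OF r] flipst_in_spins by (auto simp only: r'_def r''_def)
  define Z where "Z = Zexp et t T (seg r sg \<tau>) h"
  define Z' where "Z' = Zexp et (t + e) T (seg r (sg @ [s]) (last_jump n (u, \<tau>))) h"
  \<comment> \<open>Phases accumulated between t and \<open>t + e\<close>: in the old state up to
    the jump time u, in the new state afterwards.\<close>
  define b where "b = - \<i> * energy H r' * complex_of_real (u - t) + (- \<i> * energy H r'' * complex_of_real (t + e - u))"
  have e0: "0 \<le> e" using u by simp
  have nb: "norm b \<le> 4 * C * e"
  proof -
    have "norm b \<le> 2 * C * e + 2 * C * e"
      unfolding b_def using norm_energy_le[OF r'(1)] norm_energy_le[OF r'(2)] u C_nonneg
      by (intro norm_triangle_le add_mono) (auto simp: norm_mult simp del: of_real_diff of_real_add intro!: mult_mono)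
    then show ?thesis by simp
  qed
  have nb1: "norm b \<le> 4 * C" using nb mult_left_mono[OF e, of "4 * C"] C_nonneg by simp
  have Yu: "Yw H u r sg \<tau> = Yw H t r sg \<tau> * exp (- \<i> * energy H r' * complex_of_real (u - t))"
    using Yw_shift[of H t "u - t" r sg \<tau>] n by (simp add: r'_def)
  have "wt (t + e) r (sg @ [s]) h (last_jump n (u, \<tau>)) = jumpfac H s r' * Xw H \<rho> t r sg \<tau> * exp (b + Z')"
    unfolding wt_def Z'_def[symmetric] Xw_def Yw_last_jump[OF n] r'_def[symmetric] r''_def[symmetric] Yu b_def exp_add
    by (simp only: mult_ac)
  then have "wt (t + e) r (sg @ [s]) h (last_jump n (u, \<tau>)) - jumpfac H s r' * wt t r sg h \<tau>
     = jumpfac H s r' * (Xw H \<rho> t r sg \<tau> * (exp (b + Z') - exp Z))"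
    by (simp add: wt_def Z_def algebra_simps)
  moreover have "norm (exp (b + Z') - exp Z) \<le> exp (4 * C + zbound (t + 1)) * (lipc t (length sh) * e)"
  proof -
    have z: "norm Z' \<le> zbound (t + 1)" "norm Z \<le> zbound (t + 1)"
      using norm_Zexp_le[OF spin_path_seg[OF r] h, of "t+e" "sg @ [s]" "last_jump n (u, \<tau>)"] zbound_mono[of "t+e" "t+1"]
        norm_Zexp_le[OF spin_path_seg[OF r] h, of t sg \<tau>] zbound_mono[of t "t+1"] t e e0
      by (auto simp: Z_def Z'_def)
    have "norm (exp (b + Z') - exp Z) \<le> exp (4 * C + zbound (t + 1)) * norm (b + Z' - Z)"
      using nb1 z C_nonneg by (intro norm_exp_diff_le norm_triangle_le) auto
    also have "norm (b + Z' - Z) \<le> norm b + norm (Z' - Z)"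
      using norm_triangle_ineq[of b "Z' - Z"] by (simp add: algebra_simps)
    also have "\<dots> \<le> 4 * C * e + (16 * M * (t + T) * (1 + real (length sh)) + 4 * M * T) * e"
      unfolding Z_def Z'_def by (intro add_mono nb Zexp_last_jump_diff[OF r h t n u \<tau> q h_eq])
    also have "\<dots> = lipc t (length sh) * e" by (simp add: lipc_def algebra_simps)
    finally show ?thesis by simp
  qed
  ultimately have "norm (wt (t + e) r (sg @ [s]) h (last_jump n (u, \<tau>)) - jumpfac H s r' * wt t r sg h \<tau>)
     \<le> C * ((R * C ^ n) * (exp (4 * C + zbound (t + 1)) * (lipc t (length sh) * e)))"
    using norm_jumpfac_le[OF r'(1), of s] norm_Xw_le[OF r, of t sg \<tau>] n R_nonneg C_nonneg
    by (simp only: norm_mult) (intro mult_mono mult_nonneg_nonneg, auto)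
  then show ?thesis by (simp add: r'_def algebra_simps)
qed

text \<open>The quotient is an average over the jump time u of integrals over
  \<open>tsimplex u n\<close>. On the part \<open>tsimplex t n\<close> the weight is within O(e) of
  its value at time t; in the shell beyond it another jump falls after t, and the volume of that
  shell tends to 0.\<close>

lemma rem_snoc_limit:
  assumes r: "r \<in> spins \<times> spins" and t: "0 < t" and n: "length sg = n" and q: "q \<in> spins \<times> spins"
    and h_eq: "h = step_path q sh a" and neg: "\<And>x. x < 0 \<Longrightarrow> h x = flipst s (states r sg n)"
  shows "((\<lambda>e. rem t e r (sg @ [s]) h / complex_of_real e) \<longlongrightarrow> jumpfac H s (states r sg n) * amp t r sg h) (at_right 0)"
proof -
  have h: "spin_path h" unfolding h_eq by (rule spin_path_step_path[OF q])
  have l: "length (sg @ [s]) = Suc n" using n by simp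
  define J where "J = jumpfac H s (states r sg n)"
  define K1 where "K1 = R * C ^ Suc n * exp (4 * C + zbound (t + 1)) * lipc t (length sh) * (t ^ n / fact n)"
  define K2 where "K2 = R * C ^ Suc n * exp (zbound (t + 1)) / fact n"
  \<comment> \<open>\<open>K1\<close> belongs to the weights on \<open>tsimplex t n\<close>,
    \<open>K2\<close> to the shell, whose volume is largest at the right end
    \<open>u = t + e\<close>.\<close>
  define \<eta> where "\<eta> = (\<lambda>e. K1 * e + K2 * ((t + e) ^ n - t ^ n))"
  have main: "norm (rem t e r (sg @ [s]) h / complex_of_real e - J * amp t r sg h) \<le> \<eta> e" if e: "0 < e" "e \<le> 1" for e
  proof -
    define F where "F u \<tau> = wt (t + e) r (sg @ [s]) h (last_jump n (u, \<tau>))" for u \<tau>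
    define G where "G u = (LINT \<tau>:tsimplex u n|tvec n. F u \<tau>)" for u
    have e0: "0 \<le> e" using e by simp
    note rs = rem_snoc[OF r h t e0 n neg, folded F_def, folded G_def]
    have Fm: "F u \<in> borel_measurable (tvec n)" for u
      unfolding F_def using t e by (intro wt_measurable_last_jump r h l) auto
    have Fb: "norm (F u \<tau>) \<le> R * C ^ Suc n * exp (zbound (t + 1))" for u \<tau>
      unfolding F_def using norm_wt_le_mono[OF r h, of "t+e" "t+1" "sg @ [s]"] t e n by simp
    have Gb: "norm (G u - J * amp t r sg h) \<le> \<eta> e" if u: "u \<in> {t..<t+e}" for u
    proof -
      have u0: "0 < u" using u t by simp
      have sub: "tsimplex t n \<subseteq> tsimplex u n" using u by (intro tsimplex_mono) auto
      let ?S = "tsimplex u n - tsimplex t n"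
      have i1: "set_integrable (tvec n) (tsimplex t n) (F u)"
        by (rule bounded_set_integrable_tsimplex(1)[OF Fm Fb order_refl _ t]) auto
      have i2: "set_integrable (tvec n) ?S (F u)"
        by (rule bounded_set_integrable_tsimplex(1)[OF Fm Fb _ _ u0]) auto
      have "G u = (LINT \<tau>:tsimplex t n \<union> ?S|tvec n. F u \<tau>)"
        using sub by (simp add: G_def Un_absorb1)
      also have "\<dots> = (LINT \<tau>:tsimplex t n|tvec n. F u \<tau>) + (LINT \<tau>:?S|tvec n. F u \<tau>)"
        by (intro set_integral_Un i1 i2) auto
      finally have "G u - J * amp t r sg h = ((LINT \<tau>:tsimplex t n|tvec n. F u \<tau>) - (LINT \<tau>:tsimplex t n|tvec n. J * wt t r sg h \<tau>))
          + (LINT \<tau>:?S|tvec n. F u \<tau>)"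
        by (simp add: amp_def n)
      also have "(LINT \<tau>:tsimplex t n|tvec n. F u \<tau>) - (LINT \<tau>:tsimplex t n|tvec n. J * wt t r sg h \<tau>)
        = (LINT \<tau>:tsimplex t n|tvec n. F u \<tau> - J * wt t r sg h \<tau>)"
        using wt_set_integrable[OF r h, of t t sg] t n by (intro set_integral_diff(2)[symmetric] i1) auto
      also have "norm (\<dots> + (LINT \<tau>:?S|tvec n. F u \<tau>)) \<le> 
          R * C ^ Suc n * (exp (4 * C + zbound (t + 1)) * (lipc t (length sh) * e)) * measure (tvec n) (tsimplex t n)
          + R * C ^ Suc n * exp (zbound (t + 1)) * measure (tvec n) ?S"
      proof (intro norm_triangle_le add_mono)
        show "norm (LINT \<tau>:?S|tvec n. F u \<tau>) \<le> R * C ^ Suc n * exp (zbound (t + 1)) * measure (tvec n) ?S"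
          by (rule bounded_set_integrable_tsimplex(2)[OF Fm Fb _ _ u0]) auto
        have wm: "wt t r sg h \<in> borel_measurable (tvec n)" using t by (intro measurable_wt r h n) auto
        have "(\<lambda>\<tau>. F u \<tau> - J * wt t r sg h \<tau>) \<in> borel_measurable (tvec n)"
          using Fm[of u] wm by measurable
        moreover have "norm (F u \<tau> - J * wt t r sg h \<tau>) \<le> R * C ^ Suc n * (exp (4 * C + zbound (t + 1)) * (lipc t (length sh) * e))"
          if "\<tau> \<in> tsimplex t n" for \<tau>
          unfolding F_def J_def using u e that sub by (intro wt_last_jump_diff[OF r h t n _ _ _ _ q h_eq]) auto
        ultimately show "norm (LINT \<tau>:tsimplex t n|tvec n. F u \<tau> - J * wt t r sg h \<tau>) \<le> R * C ^ Suc n * (exp (4 * C + zbound (t + 1)) * (lipc t (length sh) * e)) * measure (tvec n) (tsimplex t n)"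
          by (rule bounded_set_integrable_tsimplex(2)[OF _ _ order_refl _ t]) auto
      qed
      also have "\<dots> = K1 * e + K2 * (u ^ n - t ^ n)"
        using t u by (simp add: measure_tsimplex measure_tsimplex_diff K1_def K2_def)
      also have "\<dots> \<le> \<eta> e"
        unfolding \<eta>_def K2_def using t u R_nonneg C_nonneg
        by (intro add_left_mono mult_left_mono diff_right_mono power_mono) auto
      finally show ?thesis .
    qed
    have c: "set_integrable lborel {t..<t+e} (\<lambda>_. J * amp t r sg h)"
      using e unfolding set_integrable_def by (intro integrable_scaleR_left integrable_real_indicator) auto
    have "rem t e r (sg @ [s]) h - complex_of_real e * (J * amp t r sg h) = (LINT u:{t..<t+e}|lborel. G u) - (LINT u:{t..<t+e}|lborel. J * amp t r sg h)"
      using e by (simp add: rs(1) set_lebesgue_integral_def scaleR_conv_of_real)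
    also have "\<dots> = (LINT u:{t..<t+e}|lborel. G u - J * amp t r sg h)"
      by (intro set_integral_diff(2)[symmetric] rs(2) c)
    also have "norm \<dots> \<le> \<eta> e * (t + e - t)"
      using e Gb by (intro norm_set_integral_interval_le set_integral_diff(1) rs(2) c) auto
    finally have "norm (rem t e r (sg @ [s]) h - complex_of_real e * (J * amp t r sg h)) \<le> \<eta> e * e" by simp
    moreover have "rem t e r (sg @ [s]) h / complex_of_real e - J * amp t r sg h
       = (rem t e r (sg @ [s]) h - complex_of_real e * (J * amp t r sg h)) / complex_of_real e"
      using e by (simp add: field_simps)
    ultimately show ?thesis using e by (simp add: norm_divide divide_le_eq)
  qed
  have "(\<eta> \<longlongrightarrow> K1 * 0 + K2 * ((t + 0) ^ n - t ^ n)) (at_right 0)"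
    unfolding \<eta>_def by (intro tendsto_intros)
  then have \<eta>: "(\<eta> \<longlongrightarrow> 0) (at_right 0)" by simp
  have "eventually (\<lambda>e::real. e \<in> {0<..<1}) (at_right 0)"
    by (rule eventually_at_right_real) simp
  then have "eventually (\<lambda>e. norm (rem t e r (sg @ [s]) h / complex_of_real e - J * amp t r sg h) \<le> \<eta> e) (at_right 0)"
    by eventually_elim (use main in auto)
  from Lim_null_comparison[OF this \<eta>] show ?thesis
    unfolding J_def by (simp add: LIM_zero_iff)
qed

end

section \<open>Limits of difference quotients\<close>

lemma vector_derivative_right_quotient:
  fixes f :: "real \<Rightarrow> complex"
  assumes "(f has_vector_derivative v) (at x)"
  shows "((\<lambda>e. (f (x + e) - f x) / complex_of_real e) \<longlongrightarrow> v) (at_right 0)"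
proof -
  have "((\<lambda>e. norm (f (x + e) - f x - e *\<^sub>R v) / norm e) \<longlongrightarrow> 0) (at_right 0)"
    using assms unfolding has_vector_derivative_def has_derivative_at
    by (auto intro: tendsto_within_subset)
  moreover have "eventually (\<lambda>e::real. e > 0) (at_right 0)" by (rule eventually_at_right_less)
  then have "eventually (\<lambda>e. norm ((f (x + e) - f x) / complex_of_real e - v) \<le> norm (f (x + e) - f x - e *\<^sub>R v) / norm e) (at_right 0)"
  proof eventually_elim
    case (elim e)
    then have "(f (x + e) - f x) / complex_of_real e - v = (f (x + e) - f x - e *\<^sub>R v) / complex_of_real e"
      by (simp add: field_simps scaleR_conv_of_real)
    then show ?case by (simp add: norm_divide)
  qed
  ultimately have "((\<lambda>e. (f (x + e) - f x) / complex_of_real e - v) \<longlongrightarrow> 0) (at_right 0)"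
    by (rule Lim_null_comparison[rotated])
  then show ?thesis by (simp add: LIM_zero_iff)
qed

lemma exp_right_quotient:
  fixes q :: "real \<Rightarrow> complex"
  assumes "((\<lambda>e. q e / complex_of_real e) \<longlongrightarrow> w) (at_right 0)"
  shows "((\<lambda>e. (exp (q e) - 1) / complex_of_real e) \<longlongrightarrow> w) (at_right 0)"
    and "((\<lambda>e. exp (q e)) \<longlongrightarrow> 1) (at_right 0)"
proof -
  have pos: "eventually (\<lambda>e::real. e > 0) (at_right 0)" by (rule eventually_at_right_less)
  have "((\<lambda>e. complex_of_real e * (q e / complex_of_real e)) \<longlongrightarrow> complex_of_real 0 * w) (at_right 0)"
    by (intro tendsto_mult tendsto_of_real tendsto_ident_at assms)
  moreover have "eventually (\<lambda>e. complex_of_real e * (q e / complex_of_real e) = q e) (at_right 0)"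
    using pos by eventually_elim simp
  ultimately have q: "(q \<longlongrightarrow> 0) (at_right 0)" by (simp add: tendsto_cong)
  from tendsto_exp[OF q] show "((\<lambda>e. exp (q e)) \<longlongrightarrow> 1) (at_right 0)" by simp
  \<comment> \<open>Caratheodory's form of the derivative avoids a division by \<open>q e\<close>,
    which may vanish.\<close>
  obtain g where g: "\<And>z::complex. exp z - exp 0 = g z * (z - 0)" "isCont g 0" "g 0 = 1"
    using DERIV_exp[of "0::complex"] unfolding CARAT_DERIV by auto
  have "((\<lambda>e. g (q e)) \<longlongrightarrow> 1) (at_right 0)"
    using isCont_tendsto_compose[OF g(2) q] g(3) by simp
  from tendsto_mult[OF this assms]
  have "((\<lambda>e. g (q e) * (q e / complex_of_real e)) \<longlongrightarrow> w) (at_right 0)" by simp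
  then show "((\<lambda>e. (exp (q e) - 1) / complex_of_real e) \<longlongrightarrow> w) (at_right 0)"
    using g(1) by simp
qed

lemma tendsto_coordinate: "((\<lambda>\<tau>. \<tau> k) \<longlongrightarrow> \<tau>0 k) (at (\<tau>0 :: nat \<Rightarrow> real) within S)"
proof -
  have "continuous_on UNIV (\<lambda>\<tau>::nat \<Rightarrow> real. \<tau> k)" by (rule continuous_on_product_coordinates)
  then show ?thesis by (auto simp: continuous_on_def intro: tendsto_within_subset)
qed

lemma tendsto_cum: "((\<lambda>\<tau>. cum \<tau> k) \<longlongrightarrow> cum \<tau>0 k) (at \<tau>0 within S)"
  unfolding cum_def by (intro tendsto_sum tendsto_coordinate)

text \<open>Nontriviality of the filter is what lets \<open>Lim\<close> in \<open>Aext\<close>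
  return the limit. The boundary point is approached by giving the leading waiting time a small
  positive value.\<close>

lemma cons0_limit_point:
  assumes T: "0 < T" and \<tau>: "\<tau> \<in> tsimplex T D"
  shows "at (cons0 D \<tau>) within tsimplex T (Suc D) \<noteq> bot"
proof
  assume bot: "at (cons0 D \<tau>) within tsimplex T (Suc D) = bot"
  define f where "f e = (cons0 D \<tau>)(0 := e)" for e
  have pos: "0 \<le> cum \<tau> D" by (intro cum_nonneg tsimplex_nonneg[OF \<tau>])
  have lt: "cum \<tau> D < T" using \<tau> T by (cases "D = 0") (auto simp: tsimplex_def cum_def)
  \<comment> \<open>\<open>f e\<close> is \<open>cons0 D \<tau>\<close> stretched by e.\<close>
  have "cum (f e) (Suc D) = e + cum \<tau> D" for e
    using cum_stretch[of "Suc D" "Suc D" e "cons0 D \<tau>"] by (simp add: stretch_def f_def cum_cons0) (simp add: cons0_def)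
  moreover have "f e \<in> PiE {..<Suc D} (\<lambda>_. UNIV)" for e
    by (auto simp: f_def cons0_def PiE_def extensional_def)
  ultimately have in_simplex: "f e \<in> tsimplex T (Suc D)" if "0 < e" "e < T - cum \<tau> D" for e
    using that \<tau> unfolding tsimplex_def[of T "Suc D"] by (auto simp: f_def cons0_def tsimplex_def)
  have "eventually (\<lambda>e. e \<in> {0<..<T - cum \<tau> D}) (at_right 0)"
    using lt by (intro eventually_at_right_real) simp
  then have ev: "eventually (\<lambda>e. f e \<in> tsimplex T (Suc D) \<and> f e \<noteq> cons0 D \<tau>) (at_right 0)"
  proof eventually_elim
    case (elim e)
    then have "f e 0 \<noteq> cons0 D \<tau> 0" by (simp add: f_def cons0_def)
    with elim in_simplex show ?case by auto
  qed
  have "continuous_on UNIV f"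
  proof (rule continuous_on_coordinatewise_then_product)
    show "continuous_on UNIV (\<lambda>e. f e i)" for i
      by (cases "i = 0") (simp_all add: f_def)
  qed
  then have "(f \<longlongrightarrow> f 0) (at_right 0)"
    by (auto simp: continuous_on_def intro: tendsto_within_subset)
  moreover have "f 0 = cons0 D \<tau>" by (auto simp: f_def cons0_def)
  ultimately have "filterlim f (at (cons0 D \<tau>) within tsimplex T (Suc D)) (at_right 0)"
    using ev by (simp add: filterlim_at)
  then have "eventually (\<lambda>e::real. False) (at_right 0)"
    unfolding bot filterlim_iff by (elim allE[of _ "\<lambda>_. False"]) simp
  then show False by simp
qed

section \<open>The memory integral of W as the rate of the new strip\<close>

lemma measure_reflect:
  fixes N :: "real set"
  assumes N: "N \<in> sets borel"
  shows "{s. v - s \<in> N} \<in> sets borel" "emeasure lborel {s. v - s \<in> N} = emeasure lborel N"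
proof -
  have "(\<lambda>s. v - s) -` N \<inter> space borel \<in> sets borel" using N by measurable
  then show 1: "{s. v - s \<in> N} \<in> sets borel" by (simp add: vimage_def)
  have "emeasure lborel N = (\<integral>\<^sup>+x. indicator N x \<partial>lborel)" using N by simp
  also have "\<dots> = (\<integral>\<^sup>+s. indicator N (v + -1 * s) \<partial>lborel)"
    using N by (subst nn_integral_real_affine[where c="-1" and t=v]) auto
  also have "\<dots> = (\<integral>\<^sup>+s. indicator {s. v - s \<in> N} s \<partial>lborel)"
    by (intro nn_integral_cong) (auto simp: indicator_def)
  also have "\<dots> = emeasure lborel {s. v - s \<in> N}" using 1 by simp
  finally show "emeasure lborel {s. v - s \<in> N} = emeasure lborel N" ..
qed

lemma integral_reflect_Icc: 
  fixes f :: "real \<Rightarrow> complex"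
  shows "integral {x - T..x} f = integral {0..T} (\<lambda>s. f (x - s))"
proof -
  have "integral {x - T..x} f = integral {- x..- (x - T)} (\<lambda>y. f (- y))"
    using Henstock_Kurzweil_Integration.integral_reflect_real[of x "x - T" f] by simp
  also have "\<dots> = integral {- x + x..- (x - T) + x} (\<lambda>s. f (- (s - x)))"
    by (rule integral_shift_Icc)
  finally show ?thesis by simp
qed

context bath
begin

text \<open>A row of the strip after the substitution \<open>s = x1 - x2\<close>, with the outer
  state frozen to \<open>r\<close> and the segment read backwards from \<open>v\<close>. With
  \<open>v = T\<close> and the final state as \<open>r\<close> it is the integral in
  \<open>Wfun\<close>.\<close>

definition bath_row :: "(real \<Rightarrow> int \<times> int) \<Rightarrow> int \<times> int \<Rightarrow> real \<Rightarrow> complex" where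
  "bath_row h r v = integral {0..T} (\<lambda>s. complex_of_real (real_of_int (fst r - snd r)) *
          (et s * pc h (v - s) - cnj (et s) * mc h (v - s)))"

text \<open>\<open>h (v - s)\<close> and \<open>h (w - s)\<close> disagree only for s in a set of
  measure at most \<open>length sh * \<bar>v - w\<bar>\<close>, where the integrands differ by at
  most \<open>8 * M\<close>.\<close>

lemma bath_row_diff:
  assumes q: "q \<in> spins \<times> spins" and r: "r \<in> spins \<times> spins" and h: "h = step_path q sh a"
  shows "norm (bath_row h r v - bath_row h r w) \<le> 8 * M * (real (length sh) * \<bar>v - w\<bar>)"
proof -
  have hp: "spin_path h" unfolding h by (rule spin_path_step_path[OF q])
  define f where "f v s = complex_of_real (real_of_int (fst r - snd r)) * (et s * pc h (v - s) - cnj (et s) * mc h (v - s))" for v s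
  have [measurable]: "cnj \<in> borel_measurable borel"
    by (intro borel_measurable_continuous_onI continuous_intros)
  note [measurable] = measurable_pc[OF hp] measurable_mc[OF hp]
  have fm [measurable]: "f v \<in> borel_measurable borel" for v unfolding f_def by measurable
  have fb: "norm (f v s) \<le> 4 * M" if "s \<in> {0..T}" for v s
  proof -
    have "\<bar>fst r - snd r\<bar> \<le> 2" using r by (auto simp: spins_def)
    then have "norm (complex_of_real (real_of_int (fst r - snd r))) \<le> 2"
      by (simp only: norm_of_real)
    moreover have "norm (et s * pc h (v - s) - cnj (et s) * mc h (v - s)) \<le> M * 1 + M * 1"
      using et_bound[OF that] M_nonneg
      by (intro norm_triangle_le_diff add_mono)
         (simp_all only: norm_mult complex_mod_cnj, (intro mult_mono norm_pc_le norm_mc_le hp norm_ge_zero; simp)+)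
    ultimately have "norm (f v s) \<le> 2 * (M * 1 + M * 1)"
      unfolding f_def norm_mult by (intro mult_mono) auto
    then show ?thesis by simp
  qed
  have i: "set_integrable lborel {0..T} (f v)" for v
    unfolding set_integrable_def
    by (intro integrableI_bounded_set_indicator[where B="4 * M"] AE_I2) (use fb in \<open>auto simp: emeasure_lborel_Icc_eq\<close>)
  have row: "bath_row h r v = (LINT s:{0..T}|lborel. f v s)" for v
    unfolding bath_row_def f_def[symmetric] by (rule set_borel_integral_eq_integral(2)[OF i, symmetric])
  obtain N where N: "N \<in> sets borel" 
    "emeasure lborel N \<le> ennreal (\<Sum>k=1..length sh. \<bar>a k - (a k + (w - v))\<bar>)"
    "\<And>x. x \<notin> N \<Longrightarrow> step_path q sh a x = step_path q sh (\<lambda>k. a k + (w - v)) x"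
    by (rule step_path_diff[of a "\<lambda>k. a k + (w - v)" sh q]) blast
  have sh: "h (v - s) = h (w - s)" if "w - s \<notin> N" for s
    using N(3)[OF that] unfolding h by (simp add: step_path_def algebra_simps)
  define N' where "N' = {s. w - s \<in> N}"
  have N': "N' \<in> sets borel" "emeasure lborel N' \<le> ennreal (real (length sh) * \<bar>v - w\<bar>)"
    using measure_reflect[OF N(1), of w] N(2) by (simp_all add: N'_def abs_minus_commute)
  then have fin: "emeasure lborel N' < \<infinity>" using le_less_trans by fastforce
  have m: "measure lborel N' \<le> real (length sh) * \<bar>v - w\<bar>"
    unfolding measure_def using N'(2) by (intro enn2real_leI) auto
  have "bath_row h r v - bath_row h r w = (LINT s:{0..T}|lborel. f v s - f w s)"
    unfolding row by (rule set_integral_diff(2)[OF i i, symmetric])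
  also have "norm \<dots> \<le> (\<integral>s. 8 * M * indicator N' s \<partial>lborel)"
    unfolding set_lebesgue_integral_def
  proof (rule Bochner_Integration.integral_norm_bound_integral)
    show "integrable lborel (\<lambda>s. indicat_real {0..T} s *\<^sub>R (f v s - f w s))"
      using set_integral_diff(1)[OF i i] by (simp only: set_integrable_def)
    show "integrable lborel (\<lambda>s. 8 * M * indicat_real N' s)" using N' fin by auto
    show "norm (indicat_real {0..T} s *\<^sub>R (f v s - f w s)) \<le> 8 * M * indicat_real N' s" for s
    proof (cases "s \<in> N'")
      case True
      have "norm (f v s - f w s) \<le> 4 * M + 4 * M" if "s \<in> {0..T}"
        using that by (intro norm_triangle_le_diff add_mono fb)
      with True M_nonneg show ?thesis by (auto simp: indicator_def)
    next
      case False
      then have "f v s = f w s" using sh[of s] by (simp add: f_def N'_def pc_def mc_def)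
      then show ?thesis using False by simp
    qed
  qed
  also have "\<dots> = 8 * M * measure lborel N'" using N' by simp
  also have "\<dots> \<le> 8 * M * (real (length sh) * \<bar>v - w\<bar>)"
    using m M_nonneg by (intro mult_left_mono) auto
  finally show ?thesis .
qed

text \<open>For outer times in the new strip the argument \<open>v = x1 - t - e\<close> runs over
  \<open>{T - e..T}\<close>. The rows are Lipschitz in v, so their average tends to the row at
  T.\<close>

lemma Phi_right_quotient:
  assumes q: "q \<in> spins \<times> spins" and t: "0 \<le> t" and h: "h = step_path q sh a"
    and a: "a0 < T" "\<And>x. a0 \<le> x \<Longrightarrow> h x = r" and r: "r \<in> spins \<times> spins"
  shows "((\<lambda>e. Phi et T (t + T) (t + T + e) (\<lambda>x. h (x - t - e)) / complex_of_real e) \<longlongrightarrow> bath_row h r T) (at_right 0)"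
proof -
  have hp: "spin_path h" unfolding h by (rule spin_path_step_path[OF q])
  define P where "P e = Phi et T (t + T) (t + T + e) (\<lambda>x. h (x - t - e))" for e
  have main: "norm (P e / complex_of_real e - bath_row h r T) \<le> 8 * M * real (length sh) * e" 
    if e: "0 < e" "e < T - a0" for e
  proof -
    let ?G = "\<lambda>x. h (x - t - e)"
    have G: "spin_path ?G" using spin_path_shift[OF hp, of "t + e"] by (simp add: algebra_simps)
    define ro where "ro x1 = integral {max 0 (x1 - T)..x1} (kern et ?G x1)" for x1
    have tT: "0 \<le> t + T" using t T_pos by simp
    have ro: "ro x1 = bath_row h r (x1 - t - e)" if x1: "x1 \<in> {t + T..t + T + e}" for x1
    proof -
      \<comment> \<open>By \<open>e < T - a0\<close> the argument lies beyond \<open>a0\<close>,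
        where the segment has the constant value \<open>r\<close>.\<close>
      have G1: "?G x1 = r" using e x1 by (intro a(2)) auto
      have "ro x1 = integral {x1 - T..x1} (kern et ?G x1)"
        using x1 t by (simp add: ro_def max_def)
      also have "\<dots> = integral {0..T} (\<lambda>s. kern et ?G x1 (x1 - s))" by (rule integral_reflect_Icc)
      also have "\<dots> = bath_row h r (x1 - t - e)"
        unfolding bath_row_def using G1
        by (intro Henstock_Kurzweil_Integration.integral_cong) (simp add: kern_def pc_def mc_def algebra_simps)
      finally show ?thesis .
    qed
    have "(ro has_integral P e) {t + T..t + T + e}"
      using Phi_iterated(2,3)[OF G tT, of "t + T + e"] integrable_integral unfolding P_def ro_def by simp
    moreover have "((\<lambda>_. bath_row h r T) has_integral (e *\<^sub>R bath_row h r T)) {t + T..t + T + e}"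
      using has_integral_const_real[of "bath_row h r T" "t + T" "t + T + e"] e by simp
    ultimately have "((\<lambda>x. ro x - bath_row h r T) has_integral (P e - e *\<^sub>R bath_row h r T)) {t + T..t + T + e}"
      by (rule has_integral_diff)
    then have "norm (P e - e *\<^sub>R bath_row h r T) \<le> 8 * M * (real (length sh) * e) * Henstock_Kurzweil_Integration.content {t + T..t + T + e}"
    proof (rule has_integral_bound_real[OF _ finite.emptyI, rotated])
      show "0 \<le> 8 * M * (real (length sh) * e)" using M_nonneg e by simp
      fix x assume x: "x \<in> {t + T..t + T + e} - {}"
      have "norm (ro x - bath_row h r T) \<le> 8 * M * (real (length sh) * \<bar>x - t - e - T\<bar>)"
        using x ro[of x] bath_row_diff[OF q r h, of "x - t - e" T] by simp
      also have "\<dots> \<le> 8 * M * (real (length sh) * e)"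
        using x M_nonneg by (intro mult_left_mono) auto
      finally show "norm (ro x - bath_row h r T) \<le> 8 * M * (real (length sh) * e)" .
    qed
    then have b: "norm (P e - e *\<^sub>R bath_row h r T) \<le> 8 * M * real (length sh) * e * e"
      using e by simp
    have "P e / complex_of_real e - bath_row h r T = (P e - e *\<^sub>R bath_row h r T) / complex_of_real e"
      using e by (simp add: field_simps scaleR_conv_of_real)
    then show ?thesis using b e by (simp add: norm_divide divide_le_eq)
  qed
  have "((\<lambda>e. 8 * M * real (length sh) * e) \<longlongrightarrow> 8 * M * real (length sh) * 0) (at_right 0)"
    by (intro tendsto_intros)
  then have z: "((\<lambda>e. 8 * M * real (length sh) * e) \<longlongrightarrow> 0) (at_right 0)" by simp
  have "eventually (\<lambda>e::real. e \<in> {0<..<T - a0}) (at_right 0)"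
    using a(1) by (intro eventually_at_right_real) simp
  then have "eventually (\<lambda>e. norm (P e / complex_of_real e - bath_row h r T) \<le> 8 * M * real (length sh) * e) (at_right 0)"
    by eventually_elim (use main in auto)
  from Lim_null_comparison[OF this z] show ?thesis
    by (simp add: LIM_zero_iff P_def)
qed

end

section \<open>Summation over histories\<close>

definition sector :: "nat \<Rightarrow> int \<times> int \<Rightarrow> (int \<times> int \<Rightarrow> sign list \<Rightarrow> complex) \<Rightarrow> complex" where
  "sector n r0 F = (\<Sum>r\<in>spins \<times> spins. \<Sum>sg\<in>{l. length l = n}. if states r sg n = r0 then F r sg else 0)"

lemma norm_sector_le:
  assumes "\<And>r sg. r \<in> spins \<times> spins \<Longrightarrow> length sg = n \<Longrightarrow> states r sg n = r0 \<Longrightarrow> norm (F r sg) \<le> B" "0 \<le> B"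
  shows "norm (sector n r0 F) \<le> 4 * 2 ^ n * B"
proof -
  have "norm (sector n r0 F) \<le> (\<Sum>r\<in>spins \<times> spins. \<Sum>sg\<in>{l :: sign list. length l = n}. B)"
    unfolding sector_def using assms by (intro sum_norm_le) auto
  also have "\<dots> = 4 * 2 ^ n * B"
    by (simp add: card_sign_lists card_cartesian_product spins_def)
  finally show ?thesis .
qed

lemma sector_tendsto:
  assumes "\<And>r sg. r \<in> spins \<times> spins \<Longrightarrow> length sg = n \<Longrightarrow> states r sg n = r0 \<Longrightarrow> ((\<lambda>x. F x r sg) \<longlongrightarrow> L r sg) A"
  shows "((\<lambda>x. sector n r0 (F x)) \<longlongrightarrow> sector n r0 L) A"
  unfolding sector_def using assms by (intro tendsto_sum) auto

lemma sector_cong: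
  assumes "\<And>r sg. r \<in> spins \<times> spins \<Longrightarrow> length sg = n \<Longrightarrow> states r sg n = r0 \<Longrightarrow> F r sg = G r sg"
  shows "sector n r0 F = sector n r0 G"
  unfolding sector_def using assms by (intro sum.cong) auto

lemma sector_add_mult: "sector n r0 (\<lambda>r sg. c * F r sg + G r sg) = c * sector n r0 F + sector n r0 G"
  unfolding sector_def sum_distrib_left sum.distrib[symmetric] by (intro sum.cong) auto

lemma sector_divide: "sector n r0 (\<lambda>r sg. F r sg / c) = sector n r0 F / c"
  unfolding sector_def sum_divide_distrib by (intro sum.cong) auto

lemma sector_mult: "sector n r0 (\<lambda>r sg. c * F r sg) = c * sector n r0 F"
  unfolding sector_def sum_distrib_left by (intro sum.cong) auto

text \<open>Flips are involutions: a history ends in \<open>r0\<close> after a jump \<open>s\<close>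
  exactly if it was in \<open>flipst s r0\<close> before. The flipped state is the initial state of
  the boundary terms.\<close>

lemma sector_Suc: "sector (Suc n) r0 F = (\<Sum>s\<in>{Pl, Mi}. sector n (flipst s r0) (\<lambda>r sg. F r (sg @ [s])))"
proof -
  have st: "states r (sg @ [s]) (Suc n) = r0 \<longleftrightarrow> states r sg n = flipst s r0" if "length sg = n" for r sg s
    using states_snoc[of r sg s] that by auto
  have "sector (Suc n) r0 F = (\<Sum>r\<in>spins \<times> spins. \<Sum>s\<in>{Pl, Mi}. \<Sum>sg\<in>{l. length l = n}. if states r sg n = flipst s r0 then F r (sg @ [s]) else 0)"
    unfolding sector_def sum_sign_lists_Suc by (intro sum.cong refl) (simp add: st)
  then show ?thesis unfolding sector_def by (subst (asm) sum.swap)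
qed

context spin_bath
begin

definition level :: "real \<Rightarrow> int \<times> int \<Rightarrow> (real \<Rightarrow> int \<times> int) \<Rightarrow> nat \<Rightarrow> complex" where
  "level t r0 h n = sector n r0 (\<lambda>r sg. amp t r sg h)"

text \<open>There are 4 initial states and \<open>2 ^ n\<close> sign lists; the remaining factor
  bounds one amplitude. The sum over n is an exponential series in \<open>2 * C * t\<close>.\<close>

definition level_bound :: "real \<Rightarrow> nat \<Rightarrow> real" where
  "level_bound t n = 4 * 2 ^ n * (R * C ^ n * exp (zbound t) * (t ^ n / fact n))"

lemma summable_level_bound: "summable (level_bound t)"
proof -
  have "level_bound t = (\<lambda>n. (4 * R * exp (zbound t)) * (inverse (fact n) * (2 * C * t) ^ n))"
    by (auto simp: level_bound_def power_mult_distrib field_simps)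
  then show ?thesis by (simp only:) (intro summable_mult summable_exp)
qed

lemma norm_level_le:
  assumes "spin_path h" "0 < t" 
  shows "norm (level t r0 h n) \<le> level_bound t n"
  unfolding level_def level_bound_def
proof (rule norm_sector_le)
  show "0 \<le> R * C ^ n * exp (zbound t) * (t ^ n / fact n)" using assms R_nonneg C_nonneg by simp
  show "norm (amp t r sg h) \<le> R * C ^ n * exp (zbound t) * (t ^ n / fact n)" if "r \<in> spins \<times> spins" "length sg = n" for r sg
    using norm_amp_le[OF that(1) assms(1,2), of sg] that(2) by simp
qed

lemma summable_level: "spin_path h \<Longrightarrow> 0 < t \<Longrightarrow> summable (level t r0 h)"
  by (rule summable_comparison_test'[OF summable_level_bound norm_level_le])

lemma Aint_eq_level:
  assumes r0: "r0 \<in> spins \<times> spins" and t: "0 < t"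
  shows "Aint H \<rho> et T r0 sg t \<tau> = Yw H T r0 sg \<tau> * (\<Sum>n. level t r0 (seg r0 sg \<tau>) n)"
proof -
  let ?h = "seg r0 sg \<tau>"
  have "(LINT \<tau>t : tsimplex t n | tvec n.
           Xw H \<rho> t r sgt \<tau>t * (if states r sgt n = r0 then 1 else 0) * Yw H T r0 sg \<tau>
           * exp (Zexp et t T (seg r sgt \<tau>t) ?h))
      = Yw H T r0 sg \<tau> * (if states r sgt n = r0 then amp t r sgt ?h else 0)" if "length sgt = n" for n r sgt
  proof -
    have "(LINT \<tau>t : tsimplex t n | tvec n.
           Xw H \<rho> t r sgt \<tau>t * (if states r sgt n = r0 then 1 else 0) * Yw H T r0 sg \<tau>
           * exp (Zexp et t T (seg r sgt \<tau>t) ?h)) =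
       (LINT \<tau>t : tsimplex t n | tvec n. ((if states r sgt n = r0 then 1 else 0) * Yw H T r0 sg \<tau>) * wt t r sgt ?h \<tau>t)"
      by (rule set_lebesgue_integral_cong) (auto simp: wt_def)
    then show ?thesis by (simp add: amp_def that)
  qed
  then have "Aint H \<rho> et T r0 sg t \<tau> = (\<Sum>n. Yw H T r0 sg \<tau> * level t r0 ?h n)"
    unfolding Aint_def level_def sector_def sum_distrib_left
    by (intro suminf_cong sum.cong refl) auto
  also have "\<dots> = Yw H T r0 sg \<tau> * (\<Sum>n. level t r0 ?h n)"
    by (intro suminf_mult summable_level spin_path_seg r0 t)
  finally show ?thesis .
qed

text \<open>Convergence of time vectors is coordinatewise, so the finitely many jump times converge,
  and amplitudes are Lipschitz in the measure of the set where two segments differ.\<close>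

lemma tendsto_amp_boundary:
  assumes r: "r \<in> spins \<times> spins" and t: "0 < t" and q: "q \<in> spins \<times> spins" and D: "length sg = D"
  shows "((\<lambda>\<tau>'. amp t r sgt (seg q (s # sg) \<tau>')) \<longlongrightarrow> amp t r sgt (seg (flipst s q) sg \<tau>)) (at (cons0 D \<tau>) within S)"
proof -
  define m where "m \<tau>' = (\<Sum>k=1..Suc D. \<bar>cum \<tau>' k - cum (cons0 D \<tau>) k\<bar>)" for \<tau>'
  define K where "K = R * C ^ length sgt * (exp (zbound t) * (16 * M * (t + T))) * (t ^ length sgt / fact (length sgt))"
  have b: "norm (amp t r sgt (seg q (s # sg) \<tau>') - amp t r sgt (seg (flipst s q) sg \<tau>)) \<le> K * m \<tau>'" for \<tau>'
  proof -
    obtain N where N: "N \<in> sets borel" "emeasure lborel N \<le> ennreal (\<Sum>k=1..length (s # sg). \<bar>cum \<tau>' k - cum (cons0 D \<tau>) k\<bar>)"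
      "\<And>x. x \<notin> N \<Longrightarrow> step_path q (s # sg) (cum \<tau>') x = step_path q (s # sg) (cum (cons0 D \<tau>)) x"
      by (rule step_path_diff[of "cum \<tau>'" "cum (cons0 D \<tau>)" "s # sg" q]) blast
    have eq: "seg q (s # sg) \<tau>' x = seg (flipst s q) sg \<tau> x" if "0 \<le> x" "x \<notin> N" for x
      using N(3)[OF that(2)] seg_cons0[OF D that(1), of q s \<tau>] by (simp add: seg_eq_step_path)
    have "norm (amp t r sgt (seg q (s # sg) \<tau>') - amp t r sgt (seg (flipst s q) sg \<tau>))
      \<le> R * C ^ length sgt * (exp (zbound t) * (16 * M * (t + T) * m \<tau>')) * (t ^ length sgt / fact (length sgt))"
      using N(2) by (intro amp_diff_path[OF r _ _ t N(1)] spin_path_seg q flipst_in_spins eq) (auto simp: m_def D sum_nonneg)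
    then show ?thesis by (simp add: K_def algebra_simps)
  qed
  have "((\<lambda>\<tau>'. K * m \<tau>') \<longlongrightarrow> K * (\<Sum>k=1..Suc D. \<bar>cum (cons0 D \<tau>) k - cum (cons0 D \<tau>) k\<bar>)) (at (cons0 D \<tau>) within S)"
    unfolding m_def by (intro tendsto_mult tendsto_const tendsto_sum tendsto_rabs tendsto_diff tendsto_cum)
  then have "((\<lambda>\<tau>'. K * m \<tau>') \<longlongrightarrow> 0) (at (cons0 D \<tau>) within S)" by simp
  from Lim_null_comparison[OF always_eventually[OF allI[OF b]] this]
  show ?thesis by (simp add: LIM_zero_iff)
qed

lemma tendsto_Yw: "((\<lambda>\<tau>'. Yw H L r sg \<tau>') \<longlongrightarrow> Yw H L r sg \<tau>) (at \<tau> within S)"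
proof -
  have "((\<lambda>\<tau>'. piecelen L n \<tau>' j) \<longlongrightarrow> piecelen L n \<tau> j) (at \<tau> within S)" for n j
    unfolding piecelen_def
    by (cases "j < n") (auto intro!: tendsto_intros tendsto_coordinate tendsto_cum)
  then show ?thesis unfolding Yw_alt by (intro tendsto_intros)
qed

text \<open>Tannery's theorem takes the boundary limit inside the series; \<open>level_bound\<close>
  is a majorant that does not depend on the segment.\<close>

lemma Aext_boundary:
  assumes q: "q \<in> spins \<times> spins" and t: "0 < t" and D: "length sg = D" and \<tau>: "\<tau> \<in> tsimplex T D"
  shows "Aext H \<rho> et T q (s # sg) t (cons0 D \<tau>)
    = jumpfac H s q * Yw H T (flipst s q) sg \<tau> * (\<Sum>n. level t q (seg (flipst s q) sg \<tau>) n)"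
proof -
  let ?F = "at (cons0 D \<tau>) within tsimplex T (Suc D)"
  have nb: "?F \<noteq> bot" by (rule cons0_limit_point[OF T_pos \<tau>])
  have "((\<lambda>\<tau>'. \<Sum>n. level t q (seg q (s # sg) \<tau>') n) \<longlongrightarrow> (\<Sum>n. level t q (seg (flipst s q) sg \<tau>) n)) ?F"
  proof (rule tannerys_theorem[THEN conjunct2, THEN conjunct2])
    show "((\<lambda>\<tau>'. level t q (seg q (s # sg) \<tau>') n) \<longlongrightarrow> level t q (seg (flipst s q) sg \<tau>) n) ?F" for n
      unfolding level_def by (intro sector_tendsto tendsto_amp_boundary t q D)
    show "eventually (\<lambda>(n, \<tau>'). norm (level t q (seg q (s # sg) \<tau>') n) \<le> level_bound t n) (at_top \<times>\<^sub>F ?F)"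
      using norm_level_le[OF spin_path_seg[OF q] t] by (intro always_eventually) auto
  qed (use nb summable_level_bound in auto)
  from tendsto_mult[OF tendsto_Yw this]
  have "((\<lambda>\<tau>'. Aint H \<rho> et T q (s # sg) t \<tau>') \<longlongrightarrow>
     Yw H T q (s # sg) (cons0 D \<tau>) * (\<Sum>n. level t q (seg (flipst s q) sg \<tau>) n)) ?F"
    by (simp only: Aint_eq_level[OF q t])
  from tendsto_Lim[OF nb this]
  have "Lim ?F (Aint H \<rho> et T q (s # sg) t) =
     Yw H T q (s # sg) (cons0 D \<tau>) * (\<Sum>n. level t q (seg (flipst s q) sg \<tau>) n)" .
  \<comment> \<open>The leading entry is 0, so \<open>Aext\<close> takes its limit branch
    here.\<close>
  moreover have "cons0 D \<tau> \<notin> tsimplex T (Suc D)" by (auto simp: tsimplex_def cons0_def)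
  ultimately show ?thesis by (simp add: Aext_def D Yw_cons0)
qed

text \<open>One of the \<open>Suc m\<close> jumps is confined to a window of length e, which leaves
  the majorant for m jumps; \<open>2 * C\<close> accounts for the two signs and the flip factor of
  the confined jump.\<close>

lemma rem_sector_bound:
  assumes h: "spin_path h" and t: "0 < t" and e: "0 < e" "e \<le> 1" and neg: "\<And>x. x < 0 \<Longrightarrow> h x = r0"
  shows "norm (sector n r0 (\<lambda>r sg. rem t e r sg h) / complex_of_real e)
    \<le> (case n of 0 \<Rightarrow> 0 | Suc m \<Rightarrow> 2 * C * level_bound (t + 1) m)"
proof (cases n)
  case 0
  have "sector 0 r0 (\<lambda>r sg. rem t e r sg h) = sector 0 r0 (\<lambda>r sg. 0)"
  proof (rule sector_cong)
    fix r sg assume "r \<in> spins \<times> spins" "length (sg :: sign list) = 0" "states r sg 0 = r0"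
    then show "rem t e r sg h = 0" using rem_Nil[OF _ h t, of r e] neg e by simp
  qed
  then show ?thesis using 0 by (simp add: sector_def)
next
  case (Suc m)
  have "norm (sector (Suc m) r0 (\<lambda>r sg. rem t e r sg h)) \<le> 4 * 2 ^ Suc m * (R * C ^ Suc m * exp (zbound (t + 1)) * ((t + 1) ^ m / fact m) * e)"
  proof (rule norm_sector_le)
    show "0 \<le> R * C ^ Suc m * exp (zbound (t + 1)) * ((t + 1) ^ m / fact m) * e"
      using t e R_nonneg C_nonneg by simp
    fix r sg assume r: "r \<in> spins \<times> spins" and l: "length (sg :: sign list) = Suc m" and st: "states r sg (Suc m) = r0"
    obtain sg' s where sg: "sg = sg' @ [s]" using l by (cases sg rule: rev_cases) auto
    with l st have "length sg' = m" "r0 = flipst s (states r sg' m)" using states_snoc[of r sg' s] by auto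
    with norm_rem_snoc_le[OF r h t _ e(2), of sg' m s] neg e
    show "norm (rem t e r sg h) \<le> R * C ^ Suc m * exp (zbound (t + 1)) * ((t + 1) ^ m / fact m) * e"
      by (simp add: sg)
  qed
  also have "\<dots> = 2 * C * level_bound (t + 1) m * e" by (simp add: level_bound_def)
  finally show ?thesis using e Suc by (simp add: norm_divide divide_le_eq)
qed

lemma rem_sector_limit:
  assumes t: "0 < t" and q: "q \<in> spins \<times> spins" and h: "h = step_path q sh a" and neg: "\<And>x. x < 0 \<Longrightarrow> h x = r0"
  shows "((\<lambda>e. \<Sum>n. sector n r0 (\<lambda>r sg. rem t e r sg h) / complex_of_real e) \<longlongrightarrow>
    (\<Sum>s\<in>{Pl, Mi}. jumpfac H s (flipst s r0) * (\<Sum>n. level t (flipst s r0) h n))) (at_right 0)"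
proof -
  have hp: "spin_path h" unfolding h by (rule spin_path_step_path[OF q])
  define L where "L n = (case n of 0 \<Rightarrow> 0 | Suc m \<Rightarrow> \<Sum>s\<in>{Pl, Mi}. jumpfac H s (flipst s r0) * level t (flipst s r0) h m)" for n
  define B where "B n = (case n of 0 \<Rightarrow> 0 | Suc m \<Rightarrow> 2 * C * level_bound (t + 1) m)" for n
  have ev: "eventually (\<lambda>e::real. e \<in> {0<..<1}) (at_right 0)" by (rule eventually_at_right_real) simp
  have "((\<lambda>e. \<Sum>n. sector n r0 (\<lambda>r sg. rem t e r sg h) / complex_of_real e) \<longlongrightarrow> (\<Sum>n. L n)) (at_right 0)"
  proof (rule tannerys_theorem[THEN conjunct2, THEN conjunct2])
    have "eventually (\<lambda>p. True \<and> snd p \<in> {0<..<1::real}) (at_top \<times>\<^sub>F at_right 0)"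
      using eventually_prodI[OF eventually_True ev] by simp
    then show "eventually (\<lambda>(n, e). norm (sector n r0 (\<lambda>r sg. rem t e r sg h) / complex_of_real e) \<le> B n) (at_top \<times>\<^sub>F at_right 0)"
      by eventually_elim (use rem_sector_bound[OF hp t _ _ neg] in \<open>auto simp: B_def\<close>)
    have "summable (\<lambda>n. B (Suc n))"
      unfolding B_def using summable_level_bound by (simp add: summable_mult)
    then show "summable B" by (simp only: summable_Suc_iff)
    show "((\<lambda>e. sector n r0 (\<lambda>r sg. rem t e r sg h) / complex_of_real e) \<longlongrightarrow> L n) (at_right 0)" for n
    proof (cases n)
      case 0
      have "eventually (\<lambda>e. sector n r0 (\<lambda>r sg. rem t e r sg h) / complex_of_real e = L n) (at_right 0)"
        using ev
      proof eventually_elim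
        case (elim e)
        with rem_sector_bound[OF hp t _ _ neg, of e n] 0 show ?case by (simp add: L_def)
      qed
      then show ?thesis by (rule tendsto_eventually)
    next
      case (Suc m)
      have "((\<lambda>e. \<Sum>s\<in>{Pl, Mi}. sector m (flipst s r0) (\<lambda>r sg. rem t e r (sg @ [s]) h / complex_of_real e)) \<longlongrightarrow>
        (\<Sum>s\<in>{Pl, Mi}. sector m (flipst s r0) (\<lambda>r sg. jumpfac H s (flipst s r0) * amp t r sg h))) (at_right 0)"
      proof (intro tendsto_sum sector_tendsto)
        fix s r sg assume r: "r \<in> spins \<times> spins" and l: "length (sg :: sign list) = m" and st: "states r sg m = flipst s r0"
        from rem_snoc_limit[OF r t l q h, of s] neg st
        show "((\<lambda>e. rem t e r (sg @ [s]) h / complex_of_real e) \<longlongrightarrow> jumpfac H s (flipst s r0) * amp t r sg h) (at_right 0)"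
          by simp
      qed
      then show ?thesis by (simp only: Suc sector_divide sum_divide_distrib sector_Suc L_def nat.case level_def sector_mult)
    qed
  qed simp
  \<comment> \<open>A history without jumps has no late jump. The shift of the index restores the
    full series of amplitudes in front of the late jump.\<close>
  also have "(\<Sum>n. L n) = (\<Sum>n. L (Suc n))"
  proof -
    have "summable (\<lambda>n. L (Suc n))"
      unfolding L_def by (simp add: summable_add summable_mult summable_level[OF hp t])
    then have "summable L" by (simp only: summable_Suc_iff)
    moreover have "L 0 = 0" by (simp add: L_def)
    ultimately show ?thesis using suminf_split_head[of L] by simp
  qed
  also have "\<dots> = (\<Sum>s\<in>{Pl, Mi}. \<Sum>n. jumpfac H s (flipst s r0) * level t (flipst s r0) h n)"
    unfolding L_def nat.case by (rule suminf_sum) (intro summable_mult summable_level[OF hp t])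
  also have "\<dots> = (\<Sum>s\<in>{Pl, Mi}. jumpfac H s (flipst s r0) * (\<Sum>n. level t (flipst s r0) h n))"
    by (intro sum.cong refl suminf_mult summable_level[OF hp t])
  finally show ?thesis .
qed

section \<open>The evolution equation\<close>

lemma stretch_in_tsimplex:
  assumes "\<tau> \<in> tsimplex T D" "0 \<le> e" "D = 0 \<or> cum \<tau> D + e < T"
  shows "stretch D e \<tau> \<in> tsimplex T D"
proof (cases "D = 0")
  case False
  then have "cum (stretch D e \<tau>) D = cum \<tau> D + e" by (intro cum_stretch) auto
  with assms False show ?thesis
    unfolding tsimplex_def by (auto simp: stretch_def PiE_def extensional_def Pi_def)
qed (use assms in \<open>simp add: stretch_def\<close>)

lemma Wfun_eq: 
  "Wfun H et T r0 sg \<tau> = bath_row (seg r0 sg \<tau>) (states r0 sg (length sg)) T 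
    + \<i> * energy H (states r0 sg (length sg))"
  by (simp add: Wfun_def bath_row_def energy_def Let_def)

text \<open>This is exact for each e, before any limit. The common factor first carries the phase of
  \<open>r0\<close>, where every contributing history ends; \<open>Yw_stretch\<close> moves that
  phase to the final state of the segment.\<close>

lemma Aint_step:
  assumes r0: "r0 \<in> spins \<times> spins" and t: "0 < t" and e: "0 < e" "e \<le> 1" 
    and D: "length sg = D" and \<tau>: "\<tau> \<in> tsimplex T D"
  defines "h \<equiv> seg r0 sg \<tau>"
  shows "Aint H \<rho> et T r0 sg (t + e) \<tau> =
     propag t e h (states r0 sg D) * Aint H \<rho> et T r0 sg t (stretch D e \<tau>)
     + Yw H T r0 sg \<tau> * (complex_of_real e * (\<Sum>n. sector n r0 (\<lambda>r sg. rem t e r sg h) / complex_of_real e))"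
proof -
  have h: "spin_path h" unfolding h_def by (rule spin_path_seg[OF r0])
  have he: "spin_path (\<lambda>x. h (x - e))" by (rule spin_path_shift[OF h])
  have neg: "h x = r0" if "x < 0" for x using seg_neg[of \<tau> T sg] \<tau> D that by (simp add: h_def)
  define P where "P = propag t e h r0"
  let ?rem = "\<lambda>n. sector n r0 (\<lambda>r sg. rem t e r sg h)"
  have lev: "level (t + e) r0 h n = P * level t r0 (\<lambda>x. h (x - e)) n + ?rem n" for n
    unfolding level_def sector_add_mult[symmetric]
    by (rule sector_cong) (simp add: rem_def P_def)
  have s1: "summable (level (t + e) r0 h)" using t e by (intro summable_level h) auto
  have s2: "summable (\<lambda>n. P * level t r0 (\<lambda>x. h (x - e)) n)" by (intro summable_mult summable_level he t)
  have "?rem = (\<lambda>n. level (t + e) r0 h n - P * level t r0 (\<lambda>x. h (x - e)) n)" using lev by auto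
  with summable_diff[OF s1 s2] have s3: "summable ?rem" by simp
  have "(\<Sum>n. level (t + e) r0 h n) = P * (\<Sum>n. level t r0 (\<lambda>x. h (x - e)) n) + (\<Sum>n. ?rem n)"
    unfolding lev by (subst suminf_add[OF s2 s3, symmetric]) (simp add: suminf_mult summable_level he t)
  moreover have "(\<Sum>n. ?rem n) = complex_of_real e * (\<Sum>n. ?rem n / complex_of_real e)"
    using s3 e by (subst suminf_divide) auto
  moreover have "Yw H T r0 sg \<tau> * P = propag t e h (states r0 sg D) * Yw H T r0 sg (stretch D e \<tau>)"
    using Yw_stretch[OF D, of H T r0 \<tau> e] by (simp add: P_def propag_def exp_diff mult_ac)
  moreover have "seg r0 sg (stretch D e \<tau>) = (\<lambda>x. h (x - e))"
    using seg_stretch[of r0 sg e \<tau>] D by (simp add: h_def fun_eq_iff)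
  ultimately show ?thesis
    using t e by (simp add: Aint_eq_level[OF r0] flip: h_def) (simp add: algebra_simps)
qed

lemma evolution_equation:
  assumes r0: "r0 \<in> spins \<times> spins" and t: "0 < t" and D: "length sg = D" and \<tau>: "\<tau> \<in> tsimplex T D"
    and dt: "((\<lambda>s. Aext H \<rho> et T r0 sg s \<tau>) has_vector_derivative vt) (at t)"
    and d\<tau>: "D \<noteq> 0 \<Longrightarrow> ((\<lambda>u. Aext H \<rho> et T r0 sg t (\<tau>(0 := u))) has_vector_derivative v\<tau>) (at (\<tau> 0))"
    and d0: "D = 0 \<Longrightarrow> v\<tau> = 0"
  shows "vt = - Wfun H et T r0 sg \<tau> * Aext H \<rho> et T r0 sg t \<tau>
     + (\<Sum>s\<in>{Pl, Mi}. Aext H \<rho> et T (flipst s r0) (s # sg) t (cons0 D \<tau>)) + v\<tau>"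
proof -
  define A where "A = Aext H \<rho> et T r0 sg"
  define h where "h = seg r0 sg \<tau>"
  define rf where "rf = states r0 sg D"
  define Q where "Q e = propag t e h rf" for e
  define S where "S e = (\<Sum>n. sector n r0 (\<lambda>r sg. rem t e r sg h) / complex_of_real e)" for e
  have h_eq: "h = step_path r0 sg (cum \<tau>)" by (simp add: h_def seg_eq_step_path)
  have rf: "rf \<in> spins \<times> spins" unfolding rf_def by (rule states_in_spins[OF r0])
  have neg: "h x = r0" if "x < 0" for x using seg_neg[of \<tau> T sg] \<tau> D that by (simp add: h_def)
  define c where "c = cum \<tau> D"
  have c: "c < T" using \<tau> T_pos by (cases "D = 0") (auto simp: c_def tsimplex_def cum_def)
  have fin: "h x = rf" if "c \<le> x" for x
    unfolding h_def rf_def D[symmetric]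
  proof (rule seg_final)
    fix k assume "1 \<le> k" "k \<le> length sg"
    then have "cum \<tau> k \<le> cum \<tau> D" using D by (intro cum_mono tsimplex_nonneg[OF \<tau>]) auto
    then show "cum \<tau> k \<le> x" using that by (simp add: c_def)
  qed
  have W: "Wfun H et T r0 sg \<tau> = bath_row h rf T + \<i> * energy H rf"
    by (simp add: Wfun_eq h_def rf_def D)
  then have eqW: "- Wfun H et T r0 sg \<tau> = - \<i> * energy H rf - bath_row h rf T" by simp
  have "((\<lambda>e. - \<i> * energy H rf - Phi et T (t + T) (t + T + e) (\<lambda>x. h (x - t - e)) / complex_of_real e)
     \<longlongrightarrow> - \<i> * energy H rf - bath_row h rf T) (at_right 0)"
    using t by (intro tendsto_diff tendsto_const Phi_right_quotient[OF r0 _ h_eq c fin rf]) auto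
  moreover have "eventually (\<lambda>e. - \<i> * energy H rf - Phi et T (t + T) (t + T + e) (\<lambda>x. h (x - t - e)) / complex_of_real e
      = (- \<i> * energy H rf * complex_of_real e - Phi et T (t + T) (t + T + e) (\<lambda>x. h (x - t - e))) / complex_of_real e) (at_right 0)"
    using eventually_at_right_less[of "0::real"] by eventually_elim (simp add: diff_divide_distrib)
  ultimately have q: "((\<lambda>e. (- \<i> * energy H rf * complex_of_real e - Phi et T (t + T) (t + T + e) (\<lambda>x. h (x - t - e))) / complex_of_real e)
     \<longlongrightarrow> - Wfun H et T r0 sg \<tau>) (at_right 0)"
    unfolding eqW by (simp add: tendsto_cong)
  note Q1 = exp_right_quotient(1)[OF q, folded propag_def Q_def]
  have S: "(S \<longlongrightarrow> (\<Sum>s\<in>{Pl, Mi}. jumpfac H s (flipst s r0) * (\<Sum>n. level t (flipst s r0) h n))) (at_right 0)"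
    unfolding S_def by (rule rem_sector_limit[OF t r0 h_eq neg])
  have YS: "Yw H T r0 sg \<tau> * (\<Sum>s\<in>{Pl, Mi}. jumpfac H s (flipst s r0) * (\<Sum>n. level t (flipst s r0) h n))
     = (\<Sum>s\<in>{Pl, Mi}. Aext H \<rho> et T (flipst s r0) (s # sg) t (cons0 D \<tau>))"
    unfolding sum_distrib_left
    by (intro sum.cong refl) (simp add: Aext_boundary[OF flipst_in_spins[OF r0] t D \<tau>] h_def)
  have quot\<tau>: "((\<lambda>e. (A t (stretch D e \<tau>) - A t \<tau>) / complex_of_real e) \<longlongrightarrow> v\<tau>) (at_right 0)"
  proof (cases "D = 0")
    case True
    then show ?thesis by (simp add: stretch_def d0)
  next
    case False
    from vector_derivative_right_quotient[OF d\<tau>[OF False]]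
    show ?thesis using False by (simp add: stretch_def A_def)
  qed
  \<comment> \<open>A convergent difference quotient already gives continuity from the right along
    the stretched vectors.\<close>
  have A\<tau>: "((\<lambda>e. A t (stretch D e \<tau>)) \<longlongrightarrow> A t \<tau>) (at_right 0)"
  proof -
    have "((\<lambda>e. A t \<tau> + complex_of_real e * ((A t (stretch D e \<tau>) - A t \<tau>) / complex_of_real e)) \<longlongrightarrow> A t \<tau> + complex_of_real 0 * v\<tau>) (at_right 0)"
      by (intro tendsto_add tendsto_const tendsto_mult tendsto_of_real tendsto_ident_at quot\<tau>)
    moreover have "eventually (\<lambda>e. A t \<tau> + complex_of_real e * ((A t (stretch D e \<tau>) - A t \<tau>) / complex_of_real e) = A t (stretch D e \<tau>)) (at_right 0)"
      using eventually_at_right_less[of "0::real"] by eventually_elim simp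
    ultimately show ?thesis by (simp add: tendsto_cong)
  qed
  \<comment> \<open>With A' the value at the stretched vector, the splitting is Q A' - A = (Q - 1)
    A' + (A' - A).\<close>
  have "((\<lambda>e. (Q e - 1) / complex_of_real e * A t (stretch D e \<tau>) + (A t (stretch D e \<tau>) - A t \<tau>) / complex_of_real e + Yw H T r0 sg \<tau> * S e)
     \<longlongrightarrow> - Wfun H et T r0 sg \<tau> * A t \<tau> + v\<tau> + (\<Sum>s\<in>{Pl, Mi}. Aext H \<rho> et T (flipst s r0) (s # sg) t (cons0 D \<tau>))) (at_right 0)"
    unfolding YS[symmetric] by (intro tendsto_add tendsto_mult tendsto_const Q1 A\<tau> quot\<tau> S)
  \<comment> \<open>\<open>e < T - c\<close> keeps the stretched vector inside the open simplex,
    where \<open>Aext\<close> is \<open>Aint\<close>; the bound 1 serves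
    \<open>Aint_step\<close>.\<close>
  moreover have "eventually (\<lambda>e. e \<in> {0<..<min 1 (T - c)}) (at_right 0)"
    using c by (intro eventually_at_right_real) simp
  then have "eventually (\<lambda>e. (A (t + e) \<tau> - A t \<tau>) / complex_of_real e
     = (Q e - 1) / complex_of_real e * A t (stretch D e \<tau>) + (A t (stretch D e \<tau>) - A t \<tau>) / complex_of_real e + Yw H T r0 sg \<tau> * S e) (at_right 0)"
  proof eventually_elim
    case (elim e)
    then have e: "0 < e" "e \<le> 1" "cum \<tau> D + e < T" by (auto simp: c_def)
    have "stretch D e \<tau> \<in> tsimplex T D" using e by (intro stretch_in_tsimplex[OF \<tau>]) auto
    then have "A (t + e) \<tau> = Q e * A t (stretch D e \<tau>) + Yw H T r0 sg \<tau> * (complex_of_real e * S e)"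
      using Aint_step[OF r0 t e(1,2) D \<tau>] \<tau> D by (simp add: A_def Aext_def Q_def S_def h_def rf_def)
    then show ?case using e by (simp add: field_simps)
  qed
  ultimately have "((\<lambda>e. (A (t + e) \<tau> - A t \<tau>) / complex_of_real e) \<longlongrightarrow>
     - Wfun H et T r0 sg \<tau> * A t \<tau> + v\<tau> + (\<Sum>s\<in>{Pl, Mi}. Aext H \<rho> et T (flipst s r0) (s # sg) t (cons0 D \<tau>))) (at_right 0)"
    by (simp add: tendsto_cong)
  moreover have "((\<lambda>e. (A (t + e) \<tau> - A t \<tau>) / complex_of_real e) \<longlongrightarrow> vt) (at_right 0)"
    using vector_derivative_right_quotient[OF dt] by (simp add: A_def)
  ultimately have "vt = - Wfun H et T r0 sg \<tau> * A t \<tau> + v\<tau> + (\<Sum>s\<in>{Pl, Mi}. Aext H \<rho> et T (flipst s r0) (s # sg) t (cons0 D \<tau>))"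
    by (intro tendsto_unique[OF trivial_limit_at_right_real])
  then show ?thesis by (simp add: A_def)
qed

end

theorem theorem4p1:
  fixes H \<rho> :: "int \<Rightarrow> int \<Rightarrow> complex"
    and c m \<omega> :: "'j \<Rightarrow> real" and \<beta> T t :: real
    and rp rm :: int and sg :: "sign list" and \<tau> :: "nat \<Rightarrow> real"
  defines "et \<equiv> eta c m \<omega> \<beta>"
  defines "A \<equiv> Aext H \<rho> et T"
  defines "D \<equiv> length sg"
  assumes herm: "\<forall>a\<in>spins. \<forall>b\<in>spins. H a b = cnj (H b a)"
    and T_pos: "T > 0" and beta_pos: "\<beta> > 0"
    and omega_pos: "\<forall>j. \<omega> j > 0"
    and eta_summable: "\<forall>s. eta_term c m \<omega> \<beta> s summable_on UNIV"
    and eta_cont: "continuous_on UNIV et"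
    and r_spins: "rp \<in> spins" "rm \<in> spins"
    and diff_t: "\<forall>t'>0. \<forall>\<tau>'\<in>tsimplex T D. (\<lambda>s. A (rp, rm) sg s \<tau>') differentiable (at t')"
    and diff_tau1: "D \<ge> 1 \<longrightarrow> (\<forall>t'>0. \<forall>\<tau>'\<in>tsimplex T D.
                       (\<lambda>u. A (rp, rm) sg t' (\<tau>'(0 := u))) differentiable (at (\<tau>' 0)))"
    and t_pos: "t > 0" and tau_in: "\<tau> \<in> tsimplex T D"
  shows "vector_derivative (\<lambda>s. A (rp, rm) sg s \<tau>) (at t) =
           - Wfun H et T (rp, rm) sg \<tau> * A (rp, rm) sg t \<tau>
           + A (rp, - rm) (Mi # sg) t (cons0 D \<tau>)
           + A (- rp, rm) (Pl # sg) t (cons0 D \<tau>)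
           + (if D = 0 then 0 else vector_derivative (\<lambda>u. A (rp, rm) sg t (\<tau>(0 := u))) (at (\<tau> 0)))"
proof -
  have "compact (et ` {0..T})"
    by (intro compact_continuous_image continuous_on_subset[OF eta_cont]) auto
  from compact_imp_bounded[OF this] obtain M where "\<forall>z\<in>et ` {0..T}. norm z \<le> M"
    unfolding bounded_iff by blast
  then have M: "norm (et s) \<le> M" if "s \<in> {0..T}" for s using that by simp
  have le: "norm (F a b) \<le> (\<Sum>p\<in>spins \<times> spins. norm (F (fst p) (snd p)))" if "a \<in> spins" "b \<in> spins" 
    for a b and F :: "int \<Rightarrow> int \<Rightarrow> complex"
  proof -
    have "finite (spins \<times> spins)" by (simp add: spins_def)
    then show ?thesis
      using that member_le_sum[of "(a, b)" "spins \<times> spins" "\<lambda>p. norm (F (fst p) (snd p))"] by simp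
  qed
  \<comment> \<open>On the four pairs of spins the sum of all moduli is a common bound for the
    matrix entries.\<close>
  interpret spin_bath et T M H \<rho> "\<Sum>p\<in>spins \<times> spins. norm (H (fst p) (snd p))" "\<Sum>p\<in>spins \<times> spins. norm (\<rho> (fst p) (snd p))"
  proof unfold_locales
    fix a b assume ab: "a \<in> spins" "b \<in> spins"
    show "H a b = cnj (H b a)" by (rule herm[rule_format, OF ab])
    show "norm (H a b) \<le> (\<Sum>p\<in>spins \<times> spins. norm (H (fst p) (snd p)))"
      and "norm (\<rho> a b) \<le> (\<Sum>p\<in>spins \<times> spins. norm (\<rho> (fst p) (snd p)))"
      by (rule le[OF ab])+
  qed (use eta_cont T_pos M in auto)
  have r0: "(rp, rm) \<in> spins \<times> spins" using r_spins by simp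
  have D: "length sg = D" by (simp add: D_def)
  have d1: "((\<lambda>s. A (rp, rm) sg s \<tau>) has_vector_derivative vector_derivative (\<lambda>s. A (rp, rm) sg s \<tau>) (at t)) (at t)"
    using diff_t t_pos tau_in by (simp add: vector_derivative_works[symmetric])
  have d2: "((\<lambda>u. A (rp, rm) sg t (\<tau>(0 := u))) has_vector_derivative
     (if D = 0 then 0 else vector_derivative (\<lambda>u. A (rp, rm) sg t (\<tau>(0 := u))) (at (\<tau> 0)))) (at (\<tau> 0))" if "D \<noteq> 0"
    using diff_tau1 t_pos tau_in that by (simp add: vector_derivative_works[symmetric])
  show ?thesis
    unfolding A_def
    using evolution_equation[OF r0 t_pos D tau_in d1[unfolded A_def] d2[unfolded A_def]]
    by (simp add: flipst_def split del: if_split)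
qed

end
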